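(* Let $n\ge 2$, and let $\mathcal{MCG}(\mathbb{R}P^2,n)\cong B_n(\mathbb{R}P^2)/\langle\Delta_n^2\rangle$ be the mapping class group of the real projective plane with $n$ marked points. Let $a=\rho_n\sigma_{n-1}\cdots\sigma_1$ and $b=\rho_{n-1}\sigma_{n-2}\cdots\sigma_1$ in $B_n(\mathbb{R}P^2)$, and let $\overline{a},\overline{b}$ be their images in $\mathcal{MCG}(\mathbb{R}P^2,n)$. (a) The group $\mathcal{MCG}(\mathbb{R}P^2,n)$ is generated by the elements $\overline{a}$ and $\overline{b}$, which are of order $2n$ and $2(n-1)$ respectively. (b) $\operatorname{G}(\mathcal{MCG}(\mathbb{R}P^2,n))=\operatorname{TG}(\mathcal{MCG}(\mathbb{R}P^2,n))=2$. (c) The normal closure of any element of $\mathcal{MCG}(\mathbb{R}P^2,n)$ is a proper subgroup of $\mathcal{MCG}(\mathbb{R}P^2,n)$, and $\operatorname{NTG}(\mathcal{MCG}(\mathbb{R}P^2,n))=\operatorname{NG}(\mathcal{MCG}(\mathbb{R}P^2,n))=2$. In particular, $\mathcal{MCG}(\mathbb{R}P^2,n)$ is not strongly $k$-torsion generated for any $k\in\mathbb{N}$. (d) The quotient of $\mathcal{MCG}(\mathbb{R}P^2,n)$ by either the normal closure of $\overline{a}$ or the normal closure of $\overline{b}$ is isomorphic to $\mathbb{Z}_2$.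
   Context: $\mathcal{MCG}(\mathbb{R}P^2,n)$ is the group of isotopy classes of homeomorphisms of $\mathbb{R}P^2$ leaving a given $n$-point set $X$ invariant, with isotopies fixing $X$ pointwise. For $n\ge2$ it is identified with the quotient of the braid group $B_n(\mathbb{R}P^2)$ by the subgroup generated by the full twist $\Delta_n^2=(\sigma_1\cdots\sigma_{n-1})^n$ (which is central of order $2$). The group $B_n(\mathbb{R}P^2)=\pi_1(F_n(\mathbb{R}P^2)/S_n)$, where $F_n(\mathbb{R}P^2)$ is the space of ordered $n$-tuples of distinct points, has a presentation (Van Buskirk) with generators $\sigma_1,\dots,\sigma_{n-1},\rho_1,\dots,\rho_n$ and relations: $\sigma_i\sigma_j=\sigma_j\sigma_i$ if $|i-j|\ge2$; $\sigma_i\sigma_{i+1}\sigma_i=\sigma_{i+1}\sigma_i\sigma_{i+1}$ for $1\le i\le n-2$; $\sigma_i\rho_j=\rho_j\sigma_i$ for $j\ne i,i+1$; $\rho_{i+1}=\sigma_i^{-1}\rho_i\sigma_i^{-1}$ for $1\le i\le n-1$; $\rho_{i+1}^{-1}\rho_i^{-1}\rho_{i+1}\rho_i=\sigma_i^2$ for $1\le i\le n-1$; $\rho_1^2=\sigma_1\sigma_2\cdots\sigma_{n-2}\sigma_{n-1}^2\sigma_{n-2}\cdots\sigma_2\sigma_1$. For a group $\Gamma$, $\operatorname{G}(\Gamma)$ (resp. $\operatorname{NG}(\Gamma)$) is the minimal cardinality of a subset $X\subset\Gamma$ such that the subgroup generated by $X$ (resp. the normal closure of $X$) is $\Gamma$.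 $\operatorname{TG}(\Gamma)$ (resp. $\operatorname{NTG}(\Gamma)$) is the minimal cardinality of a subset $X\subset\Gamma$ consisting of elements of finite order such that the subgroup generated by $X$ (resp. the normal closure of $X$) is $\Gamma$. For $k\ge 2$, $\Gamma$ is strongly $k$-torsion generated if there is an element of $\Gamma$ of order $k$ whose normal closure is $\Gamma$. *)

theory Defs
  imports
    "HOL-Analysis.Analysis"
    "HOL-Algebra.Bij"
    "HOL-Algebra.Elementary_Groups"
    "HOL-Algebra.Multiplicative_Group"
    "HOL-Library.Extended_Nat"
begin

section \<open>Quotients of monoids and groups given by a presentation\<close>

text \<open>The quotient of \<open>M\<close> by a congruence \<open>r\<close> on its carrier.\<close>

definition quotient_monoid :: "'a monoid \<Rightarrow> ('a \<times> 'a) set \<Rightarrow> 'a set monoid" where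
  "quotient_monoid M r =
     \<lparr>carrier = carrier M // r,
      monoid.mult = (\<lambda>A B. \<Union>x\<in>A. \<Union>y\<in>B. r `` {x \<otimes>\<^bsub>M\<^esub> y}),
      one = r `` {\<one>\<^bsub>M\<^esub>}\<rparr>"

text \<open>The letter \<open>(x, True)\<close> stands for the generator \<open>x\<close> and \<open>(x, False)\<close> for its inverse.
  A relation \<open>(u, v)\<close> stands for \<open>u = v\<close>.\<close>

type_synonym 'g word = "('g \<times> bool) list"

definition words :: "'g set \<Rightarrow> 'g word set" where
  "words S = lists (S \<times> UNIV)"

definition word_monoid :: "'g set \<Rightarrow> 'g word monoid" where
  "word_monoid S = \<lparr>carrier = words S, monoid.mult = (@), one = []\<rparr>"

inductive_set presentation_cong ::
    "'g set \<Rightarrow> ('g word \<times> 'g word) set \<Rightarrow> ('g word \<times> 'g word) set"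
  for S :: "'g set" and R :: "('g word \<times> 'g word) set" where
  refl: "w \<in> words S \<Longrightarrow> (w, w) \<in> presentation_cong S R"
| sym: "(u, v) \<in> presentation_cong S R \<Longrightarrow> (v, u) \<in> presentation_cong S R"
| trans: "(u, v) \<in> presentation_cong S R \<Longrightarrow> (v, w) \<in> presentation_cong S R
    \<Longrightarrow> (u, w) \<in> presentation_cong S R"
| append: "(u, u') \<in> presentation_cong S R \<Longrightarrow> (v, v') \<in> presentation_cong S R
    \<Longrightarrow> (u @ v, u' @ v') \<in> presentation_cong S R"
| cancel: "x \<in> S \<Longrightarrow> ([(x, e), (x, \<not> e)], []) \<in> presentation_cong S R"
| relation: "(u, v) \<in> R \<Longrightarrow> u \<in> words S \<Longrightarrow> v \<in> words S \<Longrightarrow> (u, v) \<in> presentation_cong S R"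

definition presented_group ::
    "'g set \<Rightarrow> ('g word \<times> 'g word) set \<Rightarrow> 'g word set monoid" where
  "presented_group S R = quotient_monoid (word_monoid S) (presentation_cong S R)"

lemma presentation_cong_words:
  "(u, v) \<in> presentation_cong S R \<Longrightarrow> u \<in> words S \<and> v \<in> words S"
  by (induction rule: presentation_cong.induct) (auto simp: words_def)

lemma equiv_presentation_cong: "equiv (words S) (presentation_cong S R)"
proof (rule equivI)
  show "presentation_cong S R \<subseteq> words S \<times> words S"
    using presentation_cong_words by fast
  show "refl_on (words S) (presentation_cong S R)"
    by (intro refl_onI presentation_cong.refl)
  show "sym_on UNIV (presentation_cong S R)"
    by (rule symI) (rule presentation_cong.sym)
  show "trans_on UNIV (presentation_cong S R)"
    by (rule transI) (rule presentation_cong.trans)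
qed

lemma presented_group_mult:
  assumes "u \<in> words S" "v \<in> words S"
  shows "presentation_cong S R `` {u} \<otimes>\<^bsub>presented_group S R\<^esub> presentation_cong S R `` {v}
       = presentation_cong S R `` {u @ v}"
proof -
  have "presentation_cong S R `` {x @ y} = presentation_cong S R `` {u @ v}"
    if "(u, x) \<in> presentation_cong S R" "(v, y) \<in> presentation_cong S R" for x y
    using equiv_class_eq[OF equiv_presentation_cong presentation_cong.append[OF that]] by simp
  hence "(\<Union>x\<in>presentation_cong S R `` {u}. \<Union>y\<in>presentation_cong S R `` {v}.
      presentation_cong S R `` {x @ y})
    = (\<Union>x\<in>presentation_cong S R `` {u}. \<Union>y\<in>presentation_cong S R `` {v}.
      presentation_cong S R `` {u @ v})"
    by (intro SUP_cong refl) auto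
  also have "\<dots> = presentation_cong S R `` {u @ v}"
    using presentation_cong.refl[OF assms(1), of R] presentation_cong.refl[OF assms(2), of R]
    by (simp only: UN_constant split: if_splits) blast
  finally show ?thesis
    by (simp add: presented_group_def quotient_monoid_def word_monoid_def)
qed

lemma group_presented_group: "group (presented_group S R)"
proof -
  let ?G = "presented_group S R" and ?c = "\<lambda>w. presentation_cong S R `` {w}"
  have car: "carrier ?G = ?c ` words S"
    by (auto simp: presented_group_def quotient_monoid_def word_monoid_def quotient_def)
  have one: "\<one>\<^bsub>?G\<^esub> = ?c []"
    by (simp add: presented_group_def quotient_monoid_def word_monoid_def)
  have app: "u @ v \<in> words S" if "u \<in> words S" "v \<in> words S" for u v
    using that by (auto simp: words_def)
  have nil: "[] \<in> words S"
    by (simp add: words_def)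
  have inv: "\<exists>v\<in>words S. (v @ w, []) \<in> presentation_cong S R" if "w \<in> words S" for w
    using that
  proof (induction w)
    case Nil
    then show ?case
      by (intro bexI[of _ "[]"]) (auto intro: presentation_cong.refl)
  next
    case (Cons l w)
    obtain x e where l: "l = (x, e)" and x: "x \<in> S" and w: "w \<in> words S"
      using Cons.prems by (cases l) (auto simp: words_def)
    obtain v where v: "v \<in> words S" "(v @ w, []) \<in> presentation_cong S R"
      using Cons.IH w by blast
    have "([(x, \<not> e), (x, e)], []) \<in> presentation_cong S R"
      using presentation_cong.cancel[OF x, of "\<not> e"] by simp
    hence "((v @ [(x, \<not> e), (x, e)]) @ w, (v @ []) @ w) \<in> presentation_cong S R"
      using v(1) w by (intro presentation_cong.append presentation_cong.refl)
    hence "((v @ [(x, \<not> e)]) @ l # w, []) \<in> presentation_cong S R"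
      using v(2) l by (auto intro: presentation_cong.trans)
    moreover have "v @ [(x, \<not> e)] \<in> words S"
      using v(1) x by (auto simp: words_def)
    ultimately show ?case by blast
  qed
  show ?thesis
  proof (rule groupI)
    fix A assume "A \<in> carrier ?G"
    then obtain w where w: "w \<in> words S" "A = ?c w" using car by auto
    obtain v where v: "v \<in> words S" "(v @ w, []) \<in> presentation_cong S R"
      using inv[OF w(1)] by blast
    have "?c v \<otimes>\<^bsub>?G\<^esub> A = \<one>\<^bsub>?G\<^esub>"
      using v w presented_group_mult[OF v(1) w(1)] one
        equiv_class_eq[OF equiv_presentation_cong v(2)] by simp
    thus "\<exists>B\<in>carrier ?G. B \<otimes>\<^bsub>?G\<^esub> A = \<one>\<^bsub>?G\<^esub>"
      using v(1) car by blast
  qed (auto simp: car one presented_group_mult app nil)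
qed


section \<open>Braid groups of the projective plane\<close>

text \<open>Van Buskirk's presentation of \<open>B_n(RP\<^sup>2)\<close>. The indices of the generators start at 1.\<close>

datatype rp2_gen = Sigma_gen nat | Rho_gen nat

abbreviation (input) sg :: "nat \<Rightarrow> rp2_gen \<times> bool" where "sg i \<equiv> (Sigma_gen i, True)"
abbreviation (input) sg_inv :: "nat \<Rightarrow> rp2_gen \<times> bool" where "sg_inv i \<equiv> (Sigma_gen i, False)"
abbreviation (input) rh :: "nat \<Rightarrow> rp2_gen \<times> bool" where "rh j \<equiv> (Rho_gen j, True)"
abbreviation (input) rh_inv :: "nat \<Rightarrow> rp2_gen \<times> bool" where "rh_inv j \<equiv> (Rho_gen j, False)"

definition rp2_braid_gens :: "nat \<Rightarrow> rp2_gen set" where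
  "rp2_braid_gens n = Sigma_gen ` {1..n - 1} \<union> Rho_gen ` {1..n}"

definition rp2_braid_rels :: "nat \<Rightarrow> (rp2_gen word \<times> rp2_gen word) set" where
  "rp2_braid_rels n =
     {([sg i, sg j], [sg j, sg i]) | i j.
        i \<in> {1..n - 1} \<and> j \<in> {1..n - 1} \<and> (i + 2 \<le> j \<or> j + 2 \<le> i)}
   \<union> {([sg i, sg (i + 1), sg i], [sg (i + 1), sg i, sg (i + 1)]) | i. i \<in> {1..n - 2}}
   \<union> {([sg i, rh j], [rh j, sg i]) | i j.
        i \<in> {1..n - 1} \<and> j \<in> {1..n} \<and> j \<noteq> i \<and> j \<noteq> i + 1}
   \<union> {([rh (i + 1)], [sg_inv i, rh i, sg_inv i]) | i. i \<in> {1..n - 1}}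
   \<union> {([rh_inv (i + 1), rh_inv i, rh (i + 1), rh i], [sg i, sg i]) | i. i \<in> {1..n - 1}}
   \<union> {([rh 1, rh 1], map sg [1..<n] @ map sg (rev [1..<n]))}"

definition rp2_braid_group :: "nat \<Rightarrow> rp2_gen word set monoid" where
  "rp2_braid_group n = presented_group (rp2_braid_gens n) (rp2_braid_rels n)"

definition rp2_braid :: "nat \<Rightarrow> rp2_gen word \<Rightarrow> rp2_gen word set" where
  "rp2_braid n w = presentation_cong (rp2_braid_gens n) (rp2_braid_rels n) `` {w}"

definition full_twist :: "nat \<Rightarrow> rp2_gen word set" where
  "full_twist n = rp2_braid n (map sg [1..<n]) [^]\<^bsub>rp2_braid_group n\<^esub> n"

definition braid_a :: "nat \<Rightarrow> rp2_gen word set" where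
  "braid_a n = rp2_braid n (rh n # map sg (rev [1..<n]))"

definition braid_b :: "nat \<Rightarrow> rp2_gen word set" where
  "braid_b n = rp2_braid n (rh (n - 1) # map sg (rev [1..<n - 1]))"

definition rp2_braid_mod_twist :: "nat \<Rightarrow> rp2_gen word set set monoid" where
  "rp2_braid_mod_twist n =
     rp2_braid_group n Mod generate (rp2_braid_group n) {full_twist n}"

text \<open>The projection onto this quotient.\<close>

definition twist_class :: "nat \<Rightarrow> rp2_gen word set \<Rightarrow> rp2_gen word set set" where
  "twist_class n x = generate (rp2_braid_group n) {full_twist n} #>\<^bsub>rp2_braid_group n\<^esub> x"


section \<open>The mapping class group of the projective plane with marked points\<close>

text \<open>The projective plane is the unit sphere of \<open>\<real>\<^sup>3\<close> with antipodal points identified; its points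
  are the sets \<open>{x, - x}\<close>.\<close>

definition rp2_proj :: "real^3 \<Rightarrow> (real^3) set" where
  "rp2_proj x = {x, - x}"

definition rp2 :: "(real^3) set topology" where
  "rp2 = topology (\<lambda>U. U \<subseteq> rp2_proj ` sphere 0 1 \<and>
     openin (top_of_set (sphere 0 1)) {x \<in> sphere 0 1. rp2_proj x \<in> U})"

lemma openin_rp2:
  "openin rp2 U \<longleftrightarrow> U \<subseteq> rp2_proj ` sphere 0 1 \<and>
     openin (top_of_set (sphere 0 1)) {x \<in> sphere 0 1. rp2_proj x \<in> U}"
proof -
  let ?S = "sphere 0 1 :: (real^3) set"
  have "istopology (\<lambda>U. U \<subseteq> rp2_proj ` ?S \<and> openin (top_of_set ?S) {x \<in> ?S. rp2_proj x \<in> U})"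
    unfolding istopology_def
  proof (intro conjI allI impI)
    fix U V
    assume U: "U \<subseteq> rp2_proj ` ?S \<and> openin (top_of_set ?S) {x \<in> ?S. rp2_proj x \<in> U}"
      and V: "V \<subseteq> rp2_proj ` ?S \<and> openin (top_of_set ?S) {x \<in> ?S. rp2_proj x \<in> V}"
    show "U \<inter> V \<subseteq> rp2_proj ` ?S" using U by blast
    have "{x \<in> ?S. rp2_proj x \<in> U \<inter> V}
        = {x \<in> ?S. rp2_proj x \<in> U} \<inter> {x \<in> ?S. rp2_proj x \<in> V}" by auto
    thus "openin (top_of_set ?S) {x \<in> ?S. rp2_proj x \<in> U \<inter> V}"
      using U V by (simp only: openin_Int)
  next
    fix K
    assume K: "\<forall>U\<in>K. U \<subseteq> rp2_proj ` ?S \<and> openin (top_of_set ?S) {x \<in> ?S. rp2_proj x \<in> U}"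
    show "\<Union>K \<subseteq> rp2_proj ` ?S" using K by blast
    have "{x \<in> ?S. rp2_proj x \<in> \<Union>K} = \<Union>((\<lambda>U. {x \<in> ?S. rp2_proj x \<in> U}) ` K)" by auto
    thus "openin (top_of_set ?S) {x \<in> ?S. rp2_proj x \<in> \<Union>K}"
      using K by (simp only:) (rule openin_Union, blast)
  qed
  thus ?thesis by (simp add: rp2_def)
qed

lemma topspace_rp2: "topspace rp2 = rp2_proj ` sphere 0 1"
proof -
  have "{x \<in> sphere 0 1. rp2_proj x \<in> rp2_proj ` sphere 0 1} = sphere 0 1" by auto
  hence "openin rp2 (rp2_proj ` sphere 0 1)"
    by (simp add: openin_rp2)
  hence "rp2_proj ` sphere 0 1 \<subseteq> topspace rp2"
    by (rule openin_subset)
  moreover have "topspace rp2 \<subseteq> rp2_proj ` sphere 0 1"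
    using openin_topspace[of rp2] by (simp only: openin_rp2)
  ultimately show ?thesis by (rule subset_antisym[rotated])
qed

lemma quotient_map_rp2: "quotient_map (top_of_set (sphere 0 1)) rp2 rp2_proj"
  by (auto simp: quotient_map_def topspace_rp2 openin_rp2)

text \<open>Homeomorphisms leaving the set \<open>Q\<close> invariant. The product \<open>f g\<close> is \<open>f \<circ> g\<close>, and
  maps are \<^const>\<open>undefined\<close> off the space, as in \<^const>\<open>BijGroup\<close>.\<close>

definition homeo_group :: "'a topology \<Rightarrow> 'a set \<Rightarrow> ('a \<Rightarrow> 'a) monoid" where
  "homeo_group T Q =
     \<lparr>carrier = {f \<in> extensional (topspace T). homeomorphic_map T T f \<and> f ` Q = Q},
      monoid.mult = compose (topspace T),
      one = restrict id (topspace T)\<rparr>"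

text \<open>Isotopies are relative to the marked points: each stage of an isotopy from \<open>f\<close> agrees with
  \<open>f\<close> on \<open>Q\<close>, so that an isotopy from the identity fixes \<open>Q\<close> pointwise.\<close>

definition isotopic_rel :: "'a topology \<Rightarrow> 'a set \<Rightarrow> (('a \<Rightarrow> 'a) \<times> ('a \<Rightarrow> 'a)) set" where
  "isotopic_rel T Q =
     {(f, g). f \<in> carrier (homeo_group T Q) \<and> g \<in> carrier (homeo_group T Q) \<and>
        homotopic_with (\<lambda>h. homeomorphic_map T T h \<and> (\<forall>x\<in>Q. h x = f x)) T T f g}"

definition mapping_class_group :: "'a topology \<Rightarrow> 'a set \<Rightarrow> ('a \<Rightarrow> 'a) set monoid" where
  "mapping_class_group T Q = quotient_monoid (homeo_group T Q) (isotopic_rel T Q)"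


section \<open>Numbers of generators and of normal generators\<close>

definition normal_closure :: "('a, 'b) monoid_scheme \<Rightarrow> 'a set \<Rightarrow> 'a set" where
  "normal_closure G A = \<Inter>{N. N \<lhd> G \<and> A \<subseteq> N}"

definition torsion_elements :: "('a, 'b) monoid_scheme \<Rightarrow> 'a set" where
  "torsion_elements G = {x \<in> carrier G. \<exists>m>0. x [^]\<^bsub>G\<^esub> (m::nat) = \<one>\<^bsub>G\<^esub>}"

text \<open>The values are \<open>\<infinity>\<close> if there is no finite set with the required property.\<close>

definition gen_rank :: "('a, 'b) monoid_scheme \<Rightarrow> enat" where
  "gen_rank G = (INF A \<in> {A. A \<subseteq> carrier G \<and> finite A \<and> generate G A = carrier G}. enat (card A))"

definition normal_gen_rank :: "('a, 'b) monoid_scheme \<Rightarrow> enat" where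
  "normal_gen_rank G =
     (INF A \<in> {A. A \<subseteq> carrier G \<and> finite A \<and> normal_closure G A = carrier G}. enat (card A))"

definition torsion_gen_rank :: "('a, 'b) monoid_scheme \<Rightarrow> enat" where
  "torsion_gen_rank G =
     (INF A \<in> {A. A \<subseteq> torsion_elements G \<and> finite A \<and> generate G A = carrier G}. enat (card A))"

definition torsion_normal_gen_rank :: "('a, 'b) monoid_scheme \<Rightarrow> enat" where
  "torsion_normal_gen_rank G =
     (INF A \<in> {A. A \<subseteq> torsion_elements G \<and> finite A \<and> normal_closure G A = carrier G}.
        enat (card A))"

definition strongly_torsion_generated :: "nat \<Rightarrow> ('a, 'b) monoid_scheme \<Rightarrow> bool" where
  "strongly_torsion_generated k G \<longleftrightarrow>
     k \<ge> 2 \<and> (\<exists>x\<in>carrier G. group.ord G x = k \<and> normal_closure G {x} = carrier G)"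

end

theory Submission
  imports Defs
begin

text \<open>
  The element \<open>\<rho>\<^sub>k \<sigma>\<^bsub>k-1\<^esub> \<dots> \<sigma>\<^sub>1\<close> (\<open>rot k\<close> below) is the braid in which the first \<open>k\<close> strands
  rotate by one place, one of them running through the crosscap; \<open>a\<close> is the case \<open>k = n\<close> and \<open>b\<close> the
  case \<open>k = n - 1\<close>. The relation \<open>\<rho>\<^bsub>i+1\<^esub> = \<sigma>\<^sub>i\<^sup>-\<^sup>1 \<rho>\<^sub>i \<sigma>\<^sub>i\<^sup>-\<^sup>1\<close> pulls \<open>\<rho>\<close> through the product, so that
  also \<open>rot k = (\<sigma>\<^sub>1 \<dots> \<sigma>\<^bsub>k-1\<^esub>)\<^sup>-\<^sup>1 \<rho>\<^sub>1\<close>. Conjugation by a rotation shifts indices: it takes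
  \<open>\<sigma>\<^bsub>i+1\<^esub>\<close> to \<open>\<sigma>\<^sub>i\<close> and \<open>\<rho>\<^bsub>i+1\<^esub>\<close> to \<open>\<rho>\<^sub>i\<close>, and \<open>a\<close> takes \<open>\<rho>\<^sub>1\<close> to \<open>\<rho>\<^sub>n\<^sup>-\<^sup>1\<close> because of the last
  relation.

  Everything about orders follows from the shifts. Collecting the rotations on the right in a power of
  a product gives \<open>(rot k)\<^sup>k = \<rho>\<^sub>k \<dots> \<rho>\<^sub>1\<close> by induction on \<open>k\<close> (lemma \<open>r_rev_prod_eq_rot_pow\<close>). Since
  \<open>a\<^sup>n\<close> inverts every \<open>\<rho>\<^sub>i\<close> by conjugation, it also equals \<open>\<rho>\<^sub>n\<^sup>-\<^sup>1 \<dots> \<rho>\<^sub>1\<^sup>-\<^sup>1 = (\<rho>\<^sub>1 \<dots> \<rho>\<^sub>n)\<^sup>-\<^sup>1\<close>, and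
  the full twist \<open>(\<rho>\<^sub>1 a\<^sup>-\<^sup>1)\<^sup>n = \<rho>\<^sub>1 \<dots> \<rho>\<^sub>n a\<^sup>-\<^sup>n\<close> becomes \<open>a\<^bsup>-2n\<^esup>\<close>. Similarly \<open>b\<^bsup>2(n-1)\<^esup> = a\<^bsup>2n\<^esup>\<close>.
  As \<open>\<sigma>\<^bsub>n-1\<^esub> = b a\<^sup>-\<^sup>1\<close>, the shifts recover all generators from \<open>a\<close> and \<open>b\<close>. The full twist is thus a
  power of each of two generators, hence central, and \<open>a\<close>, \<open>b\<close> have orders dividing \<open>2n\<close> and
  \<open>2(n - 1)\<close> in the quotient. The orders are no smaller, because \<open>rot k\<close> acts as a signed
  \<open>k\<close>-cycle, of order \<open>2k\<close>, under the map sending \<open>\<sigma>\<^sub>i\<close> to a transposition and \<open>\<rho>\<^sub>j\<close> to a change of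
  sign.

  The parities of the numbers of letters \<open>\<sigma>\<close> and \<open>\<rho>\<close> define a map onto \<open>\<int>\<^sub>2 \<times> \<int>\<^sub>2\<close>. The image of
  one element lies in a subgroup of order at most 2, so its normal closure is proper; the two torsion
  generators \<open>a\<close>, \<open>b\<close> then determine all four ranks. Killing \<open>a\<close> or \<open>b\<close> leaves a cyclic group, hence an
  abelian one, generated by the image of \<open>\<sigma>\<^bsub>n-1\<^esub> = b a\<^sup>-\<^sup>1\<close>. The square of \<open>\<sigma>\<^bsub>n-1\<^esub>\<close> is a
  commutator of two \<open>\<rho>\<close>'s, so that this group has order at most 2, and it is nontrivial by the previous
  remark.

  All these arguments use only the facts collected in the locale \<open>rotation_generated_group\<close>, which
  pass along isomorphisms of groups. For the mapping class group it then suffices to know that the class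
  of the identity is its unit.
\<close>

section \<open>Products of lists and intertwining elements\<close>

definition list_prod :: "('a, 'b) monoid_scheme \<Rightarrow> 'a list \<Rightarrow> 'a" where
  "list_prod G xs = foldr (\<otimes>\<^bsub>G\<^esub>) xs \<one>\<^bsub>G\<^esub>"

lemma list_prod_Nil [simp]: "list_prod G [] = \<one>\<^bsub>G\<^esub>"
  and list_prod_Cons [simp]: "list_prod G (x # xs) = x \<otimes>\<^bsub>G\<^esub> list_prod G xs"
  by (simp_all add: list_prod_def)

context group
begin

lemma inv_cancel_left [simp]:
  assumes "x \<in> carrier G" "y \<in> carrier G"
  shows "inv x \<otimes> (x \<otimes> y) = y" "x \<otimes> (inv x \<otimes> y) = y"
  using assms by (simp_all flip: m_assoc)

text \<open>The intertwining relation \<open>x y = z x\<close> says that conjugation by \<open>x\<close> takes \<open>y\<close> to \<open>z\<close>. Written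
  without inverses it can be used from left to right while products are rearranged.\<close>

lemma inv_intertwine:
  assumes "x \<in> carrier G" "y \<in> carrier G" "z \<in> carrier G" "x \<otimes> y = z \<otimes> x"
  shows "inv x \<otimes> z = y \<otimes> inv x"
proof -
  have "inv x \<otimes> z \<otimes> x = y"
    using assms by (simp add: m_assoc flip: assms(4))
  thus ?thesis
    using assms(1-3) by (simp add: inv_solve_right)
qed

lemma intertwine_inv:
  assumes "x \<in> carrier G" "y \<in> carrier G" "z \<in> carrier G" "x \<otimes> y = z \<otimes> x"
  shows "x \<otimes> inv y = inv z \<otimes> x"
proof -
  have "z \<otimes> (x \<otimes> inv y) = x"
    using assms(1-3) by (simp add: m_assoc flip: m_assoc[of z x] assms(4))
  hence "inv z \<otimes> (z \<otimes> (x \<otimes> inv y)) = inv z \<otimes> x" by simp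
  thus ?thesis using assms(1-3) by simp
qed

lemma list_prod_closed [simp]: "set xs \<subseteq> carrier G \<Longrightarrow> list_prod G xs \<in> carrier G"
  by (induction xs) auto

lemma list_prod_append:
  "set xs \<subseteq> carrier G \<Longrightarrow> set ys \<subseteq> carrier G \<Longrightarrow>
     list_prod G (xs @ ys) = list_prod G xs \<otimes> list_prod G ys"
  by (induction xs) (auto simp: m_assoc)

lemma inv_list_prod:
  "set xs \<subseteq> carrier G \<Longrightarrow> inv (list_prod G xs) = list_prod G (map (m_inv G) (rev xs))"
proof (induction xs)
  case (Cons x xs)
  hence "list_prod G (map (m_inv G) (rev xs) @ [inv x]) = inv (list_prod G xs) \<otimes> inv x"
    by (subst list_prod_append) auto
  thus ?case
    using Cons.prems by (simp add: inv_mult_group)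
qed simp

lemma intertwine_list_prod:
  assumes "x \<in> carrier G" "\<And>y. y \<in> set ys \<Longrightarrow> c y \<in> carrier G \<and> d y \<in> carrier G"
    and "\<And>y. y \<in> set ys \<Longrightarrow> x \<otimes> c y = d y \<otimes> x"
  shows "x \<otimes> list_prod G (map c ys) = list_prod G (map d ys) \<otimes> x"
  using assms(2,3)
proof (induction ys)
  case (Cons y ys)
  have cl: "c y \<in> carrier G" "d y \<in> carrier G" "list_prod G (map c ys) \<in> carrier G"
    "list_prod G (map d ys) \<in> carrier G"
    using Cons.prems(1) by (auto intro!: list_prod_closed)
  have "x \<otimes> list_prod G (map c (y # ys)) = (x \<otimes> c y) \<otimes> list_prod G (map c ys)"
    using cl assms(1) by (simp add: m_assoc)
  also have "\<dots> = d y \<otimes> (x \<otimes> list_prod G (map c ys))"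
    using cl assms(1) Cons.prems(2)[of y] by (simp add: m_assoc)
  also have "\<dots> = d y \<otimes> (list_prod G (map d ys) \<otimes> x)"
    using Cons by simp
  finally show ?case
    using cl assms(1) by (simp add: m_assoc)
qed (use assms(1) in simp)

lemma intertwine_pow:
  assumes "x \<in> carrier G" "\<And>j. c j \<in> carrier G" "\<And>j. j < m \<Longrightarrow> x \<otimes> c j = c (Suc j) \<otimes> x"
  shows "x [^] m \<otimes> c 0 = c m \<otimes> x [^] m"
  using assms(3)
proof (induction m)
  case (Suc m)
  have "x [^] Suc m \<otimes> c 0 = x \<otimes> (x [^] m \<otimes> c 0)"
    unfolding nat_pow_Suc2[OF assms(1)] using assms(1,2) by (simp add: m_assoc)
  also have "\<dots> = (x \<otimes> c m) \<otimes> x [^] m"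
    using Suc.IH[OF Suc.prems] assms(1,2) by (simp add: m_assoc)
  also have "x \<otimes> c m = c (Suc m) \<otimes> x"
    by (rule Suc.prems) simp
  also have "\<dots> \<otimes> x [^] m = c (Suc m) \<otimes> x [^] Suc m"
    unfolding nat_pow_Suc2[OF assms(1)] using assms(1,2) by (simp add: m_assoc)
  finally show ?case .
qed (use assms in simp)

text \<open>Moving all factors \<open>x\<close> to the right past the other factors \<open>c 0\<close>: the factor \<open>c 0\<close> that stands
  behind \<open>j\<close> copies of \<open>x\<close> turns into \<open>c j\<close>.\<close>

lemma pow_mult_intertwined:
  assumes "x \<in> carrier G" "\<And>j. c j \<in> carrier G" "\<And>j. Suc j < m \<Longrightarrow> x \<otimes> c j = c (Suc j) \<otimes> x"
  shows "(c 0 \<otimes> x) [^] m = list_prod G (map c [0..<m]) \<otimes> x [^] m"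
  using assms(3)
proof (induction m)
  case (Suc m)
  have cl: "list_prod G (map c [0..<m]) \<in> carrier G"
    using assms(2) by (intro list_prod_closed) auto
  have "(c 0 \<otimes> x) [^] Suc m = list_prod G (map c [0..<m]) \<otimes> (x [^] m \<otimes> c 0) \<otimes> x"
    using Suc assms(1,2) cl by (simp add: m_assoc)
  also have "x [^] m \<otimes> c 0 = c m \<otimes> x [^] m"
    using Suc.prems by (intro intertwine_pow assms(1,2)) auto
  finally show ?case
    using assms(1,2) cl by (simp add: list_prod_append m_assoc image_subset_iff)
qed simp

end

lemma (in group_hom) hom_list_prod:
  "set xs \<subseteq> carrier G \<Longrightarrow> h (list_prod G xs) = list_prod H (map h xs)"
  by (induction xs) auto

section \<open>Normal closures, central subgroups and quotients\<close>

context group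
begin

lemma normal_closure_normal:
  assumes "A \<subseteq> carrier G"
  shows "normal_closure G A \<lhd> G"
proof (rule normal_invI)
  have "normal_closure G A \<subseteq> carrier G"
    using normal_self assms by (auto simp: normal_closure_def)
  thus "subgroup (normal_closure G A) G"
    using assms normal_self unfolding normal_closure_def
    by (intro subgroups_Inter) (auto dest: normal_imp_subgroup)
next
  fix x h assume "x \<in> carrier G" "h \<in> normal_closure G A"
  thus "x \<otimes> h \<otimes> inv x \<in> normal_closure G A"
    by (auto simp: normal_closure_def dest: normal.inv_op_closed2)
qed

lemma normal_closure_minimal: "N \<lhd> G \<Longrightarrow> A \<subseteq> N \<Longrightarrow> normal_closure G A \<subseteq> N"
  by (auto simp: normal_closure_def)

lemma normal_closure_incl: "A \<subseteq> normal_closure G A"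
  by (auto simp: normal_closure_def)

lemma normal_closure_mono: "A \<subseteq> B \<Longrightarrow> normal_closure G A \<subseteq> normal_closure G B"
  by (auto simp: normal_closure_def)

lemma generate_subset_normal_closure:
  assumes "A \<subseteq> carrier G"
  shows "generate G A \<subseteq> normal_closure G A"
  by (intro generate_subgroup_incl normal_closure_incl normal_imp_subgroup
      normal_closure_normal assms)

text \<open>In an abelian group of exponent 2 the element \<open>h x\<close> generates at most \<open>{1, h x}\<close>. The preimage of
  this subgroup is normal, contains \<open>x\<close>, and misses one of \<open>g\<close>, \<open>g'\<close>.\<close>

lemma singleton_normal_closure_proper:
  assumes "comm_group V" "h \<in> hom G V" "\<And>v. v \<in> carrier V \<Longrightarrow> v \<otimes>\<^bsub>V\<^esub> v = \<one>\<^bsub>V\<^esub>"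
    and gs: "g \<in> carrier G" "g' \<in> carrier G" "h g \<noteq> \<one>\<^bsub>V\<^esub>" "h g' \<noteq> \<one>\<^bsub>V\<^esub>" "h g \<noteq> h g'"
    and x: "x \<in> carrier G"
  shows "normal_closure G {x} \<noteq> carrier G"
proof -
  interpret V: comm_group V by fact
  interpret h: group_hom G V h
    using assms(2) by unfold_locales
  let ?N = "{y \<in> carrier G. h y \<in> {\<one>\<^bsub>V\<^esub>, h x}}"
  have inv: "inv\<^bsub>V\<^esub> v = v" if "v \<in> carrier V" for v
    using assms(3)[OF that] that by (intro V.inv_equality)
  have "subgroup ?N G"
    using x by unfold_locales (auto simp: assms(3) inv)
  moreover have "h (y \<otimes> z \<otimes> inv y) = h z" if "y \<in> carrier G" "z \<in> carrier G" for y z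
    using that by (simp add: inv V.m_ac) (simp add: assms(3) flip: V.m_assoc)
  ultimately have "?N \<lhd> G"
    by (intro normal_invI) auto
  hence "normal_closure G {x} \<subseteq> ?N"
    using x by (intro normal_closure_minimal) auto
  moreover have "\<not> (g \<in> ?N \<and> g' \<in> ?N)"
    using gs by auto
  ultimately show ?thesis using gs(1,2) by blast
qed

end

text \<open>An element that commutes with two generators of the group is central.\<close>

lemma (in group) generate_central_normal:
  assumes z: "z \<in> carrier G" and ab: "a \<in> carrier G" "b \<in> carrier G"
    and gen: "generate G {a, b} = carrier G"
    and comm: "a \<otimes> z = z \<otimes> a" "b \<otimes> z = z \<otimes> b"
  shows "generate G {z} \<lhd> G"
proof (rule normal_invI)
  show "subgroup (generate G {z}) G" using z by (intro generate_is_subgroup) simp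
  have central: "x \<otimes> z = z \<otimes> x" if "x \<in> generate G {a, b}" for x
    using that
  proof (induction rule: generate.induct)
    case (inv h)
    thus ?case using ab comm z by (auto intro!: inv_intertwine)
  next
    case (eng h1 h2)
    hence c: "h1 \<in> carrier G" "h2 \<in> carrier G" using gen by auto
    have "h1 \<otimes> h2 \<otimes> z = h1 \<otimes> (z \<otimes> h2)" using c z eng by (simp add: m_assoc)
    also have "\<dots> = z \<otimes> (h1 \<otimes> h2)" using c z eng by (simp flip: m_assoc)
    finally show ?case .
  qed (use comm z in auto)
  fix x h assume x: "x \<in> carrier G" and h: "h \<in> generate G {z}"
  from h have "h \<in> carrier G \<and> x \<otimes> h = h \<otimes> x"
  proof (induction rule: generate.induct)
    case (inv h)
    thus ?case using central[of x] x z gen by (auto intro!: intertwine_inv)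
  next
    case (eng h1 h2)
    have "x \<otimes> (h1 \<otimes> h2) = (h1 \<otimes> x) \<otimes> h2" using x eng by (simp flip: m_assoc)
    also have "\<dots> = h1 \<otimes> h2 \<otimes> x" using x eng by (simp add: m_assoc)
    finally show ?case using eng by simp
  qed (use central[of x] x z gen in auto)
  hence "x \<otimes> h \<otimes> inv x = h" using x by (simp add: m_assoc)
  thus "x \<otimes> h \<otimes> inv x \<in> generate G {z}" using h by simp
qed

lemma (in group_hom) hom_FactGroup:
  assumes N: "N \<lhd> G" and trivial: "\<And>x. x \<in> N \<Longrightarrow> h x = \<one>\<^bsub>H\<^esub>"
  shows "\<exists>k \<in> hom (G Mod N) H. \<forall>x \<in> carrier G. k (N #> x) = h x"
proof -
  interpret N: normal N G by fact
  define k where "k = (\<lambda>C. h (SOME x. x \<in> C))"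
  have k: "k (N #> x) = h x" if x: "x \<in> carrier G" for x
  proof -
    have "x \<in> N #> x" using G.rcos_self[OF x N.subgroup_axioms] .
    hence "(SOME z. z \<in> N #> x) \<in> N #> x" by (rule someI)
    then obtain y where "y \<in> N" "(SOME z. z \<in> N #> x) = y \<otimes> x" by (auto simp: r_coset_def)
    thus ?thesis using x trivial[of y] N.mem_carrier[of y] by (simp add: k_def)
  qed
  moreover have "k \<in> hom (G Mod N) H"
    by (rule homI) (auto simp: carrier_FactGroup k N.rcos_sum)
  ultimately show ?thesis by blast
qed

text \<open>The subgroup consists of the powers of \<open>g\<^sup>K\<close>. The divisibility \<open>K dvd ord g\<close> rules out that it
  contains further powers of \<open>g\<close>; it holds in particular when \<open>g\<close> has infinite order, where \<open>ord g = 0\<close>.\<close>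

lemma (in group) ord_quotient_by_power:
  assumes g: "g \<in> carrier G" and z: "z = inv (g [^] K)"
    and N: "generate G {z} \<lhd> G"
    and dvd: "K dvd ord g"
  shows "group.ord (G Mod generate G {z}) (generate G {z} #> g) = K"
proof -
  let ?N = "generate G {z}" and ?p = "\<lambda>x. generate G {z} #> x"
  interpret Q: group "G Mod ?N" by (rule normal.factorgroup_is_group[OF N])
  interpret p: group_hom G "G Mod ?N" ?p
    by (intro group_hom.intro group_hom_axioms.intro is_group Q.is_group
        normal.r_coset_hom_Mod[OF N])
  have N': "subgroup ?N G" using N by (rule normal_imp_subgroup)
  have one_iff: "?p x = \<one>\<^bsub>G Mod ?N\<^esub> \<longleftrightarrow> x \<in> ?N" if "x \<in> carrier G" for x
    using subgroup.rcos_const[OF N' is_group, of x] rcos_self[OF that N'] by auto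
  have gK: "g [^] K \<in> ?N"
  proof -
    have "z \<in> ?N" by (intro generate.incl) simp
    hence "inv z \<in> ?N" by (rule subgroup.m_inv_closed[OF N'])
    thus ?thesis using g z by simp
  qed
  have "g [^] m \<in> ?N \<longleftrightarrow> K dvd m" for m :: nat
  proof
    assume "K dvd m"
    then obtain j where "m = K * j" by blast
    hence "g [^] m = (g [^] K) [^] j" using g by (simp add: nat_pow_pow)
    moreover have "x [^] j \<in> ?N" if "x \<in> ?N" for x
      using that N' by (induction j) (simp_all add: subgroup.one_closed subgroup.m_closed)
    ultimately show "g [^] m \<in> ?N" using gK by simp
  next
    assume "g [^] m \<in> ?N"
    moreover have z': "z \<in> carrier G" "z = g [^] (- int K)"
      using g z by (simp_all add: int_pow_neg_int)
    ultimately obtain i :: int where "g [^] m = z [^] i"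
      by (auto simp: generate_pow)
    hence "g [^] int m = g [^] (- int K * i)"
      using g unfolding z'(2) by (simp add: int_pow_pow int_pow_int)
    \<comment> \<open>Two powers of \<open>g\<close> agree exactly if the exponents are congruent modulo the order, also for order 0.\<close>
    hence "int (ord g) dvd - int K * i - int m"
      using g by (simp add: int_pow_eq)
    hence "int K dvd - int K * i - int m"
      using dvd by (meson dvd_trans int_dvd_int_iff)
    moreover have "- int K * i - int m = - (int K * i + int m)" by simp
    ultimately have "int K dvd int K * i + int m" by (simp only: dvd_minus_iff)
    hence "int K dvd int m" by (simp only: dvd_add_right_iff[OF dvd_triv_left])
    thus "K dvd m" by simp
  qed
  hence "?p g [^]\<^bsub>G Mod ?N\<^esub> m = \<one>\<^bsub>G Mod ?N\<^esub> \<longleftrightarrow> K dvd m" for m :: nat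
    using one_iff[of "g [^] m"] g p.hom_nat_pow[OF g, of m] by simp
  thus ?thesis using g by (intro Q.ord_unique[THEN iffD2]) simp_all
qed

lemma (in group) involution_generates_imp_order_2:
  assumes D: "D \<in> carrier G" "D \<otimes> D = \<one>" and gen: "generate G {D} = carrier G"
    and nontrivial: "carrier G \<noteq> {\<one>}"
  shows "G \<cong> integer_mod_group 2"
proof -
  have inv_D: "inv D = D"
    using D by (intro inv_equality)
  have "subgroup {\<one>, D} G"
    using D inv_D by unfold_locales auto
  hence "generate G {D} \<subseteq> {\<one>, D}"
    by (intro generate_subgroup_incl) auto
  hence car: "carrier G = {\<one>, D}"
    using D gen by auto
  hence "D \<noteq> \<one>" using nontrivial by auto
  hence "(\<lambda>x. if x = \<one> then 0 else 1) \<in> iso G (integer_mod_group 2)"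
    using D unfolding iso_def hom_def bij_betw_def inj_on_def car
    using D(1)[THEN l_one] D(1)[THEN r_one] by (auto simp: carrier_integer_mod_group image_def)
  thus ?thesis by (auto simp: is_iso_def)
qed

text \<open>The image is generated by \<open>D = h (b a\<^sup>-\<^sup>1)\<close>, since \<open>D\<close> is \<open>h b\<close> or \<open>(h a)\<^sup>-\<^sup>1\<close>. It is therefore
  cyclic and abelian, so that the commutator \<open>(b a\<^sup>-\<^sup>1)\<^sup>2\<close> dies and \<open>D\<close> is an involution.\<close>

lemma (in group_hom) image_killing_generator_order_2:
  assumes surj: "h ` carrier G = carrier H"
    and ab: "a \<in> carrier G" "b \<in> carrier G" and xy: "x \<in> carrier G" "y \<in> carrier G"
    and comm: "(b \<otimes> inv a) \<otimes> (b \<otimes> inv a) = inv x \<otimes> inv y \<otimes> x \<otimes> y"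
    and gen: "generate G {a, b} = carrier G"
    and kill: "h a = \<one>\<^bsub>H\<^esub> \<or> h b = \<one>\<^bsub>H\<^esub>"
    and nontrivial: "carrier H \<noteq> {\<one>\<^bsub>H\<^esub>}"
  shows "H \<cong> integer_mod_group 2"
proof -
  define D where "D = h b \<otimes>\<^bsub>H\<^esub> inv\<^bsub>H\<^esub> h a"
  have D: "D \<in> carrier H" using ab by (simp add: D_def)
  have "h a \<in> generate H {D} \<and> h b \<in> generate H {D}"
    using kill
  proof
    assume 1: "h a = \<one>\<^bsub>H\<^esub>"
    hence "D = h b" using ab by (simp add: D_def)
    thus ?thesis using 1 by (simp add: generate.one generate.incl)
  next
    assume 1: "h b = \<one>\<^bsub>H\<^esub>"
    hence "inv\<^bsub>H\<^esub> D = h a" using ab by (simp add: D_def)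
    moreover have "inv\<^bsub>H\<^esub> D \<in> generate H {D}" by (intro generate.inv) simp
    ultimately show ?thesis using 1 by (simp add: generate.one)
  qed
  hence "generate H (h ` {a, b}) \<subseteq> generate H {D}"
    using D by (intro H.generate_subgroup_incl H.generate_is_subgroup) auto
  moreover have "generate H (h ` {a, b}) = carrier H"
    using ab generate_img[of "{a, b}"] gen surj by simp
  ultimately have gen_D: "generate H {D} = carrier H"
    using D H.generate_incl[of "{D}"] by auto
  hence "cyclic_group H"
    using D H.generate_pow[OF D] unfolding H.cyclic_group by blast
  then interpret C: comm_group H by (rule H.cyclic_imp_abelian_group)
  have "D \<otimes>\<^bsub>H\<^esub> D = h ((b \<otimes> inv a) \<otimes> (b \<otimes> inv a))"
    using ab by (simp add: D_def)
  also have "\<dots> = inv\<^bsub>H\<^esub> h x \<otimes>\<^bsub>H\<^esub> inv\<^bsub>H\<^esub> h y \<otimes>\<^bsub>H\<^esub> (h x \<otimes>\<^bsub>H\<^esub> h y)"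
    unfolding comm using xy by (simp add: H.m_assoc)
  also have "\<dots> = inv\<^bsub>H\<^esub> (h x \<otimes>\<^bsub>H\<^esub> h y) \<otimes>\<^bsub>H\<^esub> (h x \<otimes>\<^bsub>H\<^esub> h y)"
    using xy by (simp add: C.inv_mult)
  also have "\<dots> = \<one>\<^bsub>H\<^esub>"
    using xy by simp
  finally show ?thesis
    by (intro H.involution_generates_imp_order_2[OF D _ gen_D nontrivial])
qed

lemma (in group) quotient_by_generator_order_2:
  assumes ab: "a \<in> carrier G" "b \<in> carrier G" and xy: "x \<in> carrier G" "y \<in> carrier G"
    and comm: "(b \<otimes> inv a) \<otimes> (b \<otimes> inv a) = inv x \<otimes> inv y \<otimes> x \<otimes> y"
    and gen: "generate G {a, b} = carrier G"
    and c: "c \<in> {a, b}"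
    and proper: "normal_closure G {c} \<noteq> carrier G"
  shows "G Mod normal_closure G {c} \<cong> integer_mod_group 2"
proof -
  define N where "N = normal_closure G {c}"
  have cN: "c \<in> N" using normal_closure_incl by (auto simp: N_def)
  have N: "N \<lhd> G" unfolding N_def using c ab by (intro normal_closure_normal) auto
  let ?p = "\<lambda>x. N #> x"
  have "?p \<in> hom G (G Mod N)" by (rule normal.r_coset_hom_Mod[OF N])
  hence p: "group_hom G (G Mod N) ?p"
    by (intro group_hom.intro group_hom_axioms.intro is_group normal.factorgroup_is_group[OF N])
  have one: "?p z = \<one>\<^bsub>G Mod N\<^esub>" if "z \<in> N" for z
    using that subgroup.rcos_const[OF normal_imp_subgroup[OF N] is_group] by simp
  obtain z where z: "z \<in> carrier G" "z \<notin> N"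
    using proper normal_imp_subgroup[OF N] subgroup.subset by (fastforce simp: N_def)
  have "?p z \<noteq> \<one>\<^bsub>G Mod N\<^esub>"
    using rcos_self[OF z(1) normal_imp_subgroup[OF N]] z(2) by auto
  moreover have "?p z \<in> carrier (G Mod N)"
    using z by (simp add: carrier_FactGroup)
  ultimately have "carrier (G Mod N) \<noteq> {\<one>\<^bsub>G Mod N\<^esub>}"
    by blast
  moreover have "?p a = \<one>\<^bsub>G Mod N\<^esub> \<or> ?p b = \<one>\<^bsub>G Mod N\<^esub>"
    using c one[OF cN] by auto
  ultimately show ?thesis
    unfolding N_def[symmetric]
    using group_hom.image_killing_generator_order_2[OF p carrier_FactGroup[symmetric] ab xy comm gen]
    by blast
qed

text \<open>A bijection that respects products carries a unit to an element acting as a unit, but the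
  designated \<open>\<one>\<^bsub>H\<^esub>\<close> is that element only because it is idempotent.\<close>

lemma (in group) iso_group_transport:
  assumes phi: "\<phi> \<in> iso G H" and one: "\<one>\<^bsub>H\<^esub> \<in> carrier H" "\<one>\<^bsub>H\<^esub> \<otimes>\<^bsub>H\<^esub> \<one>\<^bsub>H\<^esub> = \<one>\<^bsub>H\<^esub>"
  shows "group H"
proof -
  let ?H = "H\<lparr>carrier := \<phi> ` carrier G, one := \<phi> \<one>\<rparr>"
  have hom: "\<phi> \<in> hom G H" and img: "\<phi> ` carrier G = carrier H"
    using phi by (auto simp: iso_def bij_betw_def)
  interpret H': group ?H by (rule hom_imp_img_group[OF hom])
  have "\<one>\<^bsub>H\<^esub> = \<one>\<^bsub>?H\<^esub>"
    using one img by (intro H'.r_cancel_one[THEN iffD1, of "\<one>\<^bsub>H\<^esub>"]) auto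
  hence "?H = H" by (simp add: img)
  thus ?thesis using H'.is_group by simp
qed

section \<open>Values of words and the universal property of a presentation\<close>

definition word_value :: "('a, 'b) monoid_scheme \<Rightarrow> ('g \<Rightarrow> 'a) \<Rightarrow> 'g word \<Rightarrow> 'a" where
  "word_value G f w = list_prod G (map (\<lambda>(x, e). if e then f x else inv\<^bsub>G\<^esub> (f x)) w)"

lemma word_value_simps [simp]:
  "word_value G f [] = \<one>\<^bsub>G\<^esub>"
  "word_value G f ((x, e) # w) = (if e then f x else inv\<^bsub>G\<^esub> (f x)) \<otimes>\<^bsub>G\<^esub> word_value G f w"
  by (simp_all add: word_value_def)

lemma word_value_map_generators:
  "word_value G f (map (\<lambda>i. (g i, True)) xs) = list_prod G (map (\<lambda>i. f (g i)) xs)"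
  by (induction xs) auto

context group
begin

lemma word_value_closed:
  "f \<in> S \<rightarrow> carrier G \<Longrightarrow> w \<in> words S \<Longrightarrow> word_value G f w \<in> carrier G"
  unfolding word_value_def by (intro list_prod_closed) (fastforce simp: words_def Pi_iff)

lemma word_value_append:
  assumes "f \<in> S \<rightarrow> carrier G" "u \<in> words S" "v \<in> words S"
  shows "word_value G f (u @ v) = word_value G f u \<otimes> word_value G f v"
  using assms unfolding word_value_def map_append
  by (intro list_prod_append) (fastforce simp: words_def Pi_iff)+

lemma word_value_presentation_cong:
  assumes "(u, v) \<in> presentation_cong S R" and f: "f \<in> S \<rightarrow> carrier G"
    and rel: "\<And>u v. (u, v) \<in> R \<Longrightarrow> u \<in> words S \<Longrightarrow> v \<in> words S \<Longrightarrow>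
      word_value G f u = word_value G f v"
  shows "word_value G f u = word_value G f v"
  using assms(1)
proof (induction rule: presentation_cong.induct)
  case (append u u' v v')
  thus ?case
    using presentation_cong_words[of u u' S R] presentation_cong_words[of v v' S R]
      word_value_append[OF f] by simp
next
  case (cancel x e)
  hence "f x \<in> carrier G" using f by blast
  thus ?case by (cases e) simp_all
qed (auto dest: rel)

end

lemma carrier_presented_group:
  "carrier (presented_group S R) = (\<lambda>w. presentation_cong S R `` {w}) ` words S"
  by (auto simp: presented_group_def quotient_monoid_def word_monoid_def quotient_def)

lemma one_presented_group: "\<one>\<^bsub>presented_group S R\<^esub> = presentation_cong S R `` {[]}"
  by (simp add: presented_group_def quotient_monoid_def word_monoid_def)

theorem presented_group_universal:
  assumes "group H" and f: "f \<in> S \<rightarrow> carrier H"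
    and rel: "\<And>u v. (u, v) \<in> R \<Longrightarrow> u \<in> words S \<Longrightarrow> v \<in> words S \<Longrightarrow>
      word_value H f u = word_value H f v"
  shows "\<exists>h \<in> hom (presented_group S R) H.
    \<forall>w \<in> words S. h (presentation_cong S R `` {w}) = word_value H f w"
proof -
  interpret H: group H by fact
  define h where "h = (\<lambda>A. word_value H f (SOME w. w \<in> A))"
  have h: "h (presentation_cong S R `` {w}) = word_value H f w" if "w \<in> words S" for w
  proof -
    have "w \<in> presentation_cong S R `` {w}"
      using presentation_cong.refl[OF that] by blast
    hence "(SOME v. v \<in> presentation_cong S R `` {w}) \<in> presentation_cong S R `` {w}"
      by (rule someI)
    thus ?thesis
      using H.word_value_presentation_cong[OF _ f rel] by (simp add: h_def)
  qed
  moreover have "h \<in> hom (presented_group S R) H"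
  proof (rule homI)
    fix A assume "A \<in> carrier (presented_group S R)"
    thus "h A \<in> carrier H"
      using h H.word_value_closed[OF f] by (auto simp: carrier_presented_group)
  next
    fix A B assume "A \<in> carrier (presented_group S R)" "B \<in> carrier (presented_group S R)"
    then obtain u v where uv: "u \<in> words S" "v \<in> words S"
      "A = presentation_cong S R `` {u}" "B = presentation_cong S R `` {v}"
      by (auto simp: carrier_presented_group)
    moreover from uv(1,2) have "u @ v \<in> words S" by (auto simp: words_def)
    ultimately show "h (A \<otimes>\<^bsub>presented_group S R\<^esub> B) = h A \<otimes>\<^bsub>H\<^esub> h B"
      using h H.word_value_append[OF f] by (simp add: presented_group_mult)
  qed
  ultimately show ?thesis by blast
qed

lemma class_closed: "w \<in> words S \<Longrightarrow> presentation_cong S R `` {w} \<in> carrier (presented_group S R)"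
  by (simp add: carrier_presented_group)

lemma inv_generator_class:
  assumes "x \<in> S"
  shows "inv\<^bsub>presented_group S R\<^esub> (presentation_cong S R `` {[(x, True)]}) =
    presentation_cong S R `` {[(x, False)]}"
proof -
  interpret group "presented_group S R" by (rule group_presented_group)
  have "presentation_cong S R `` {[(x, False)]} \<otimes>\<^bsub>presented_group S R\<^esub>
      presentation_cong S R `` {[(x, True)]} = presentation_cong S R `` {[(x, False)] @ [(x, True)]}"
    using assms by (intro presented_group_mult) (auto simp: words_def)
  also have "\<dots> = presentation_cong S R `` {[]}"
    using presentation_cong.cancel[OF assms, of False R]
    by (intro equiv_class_eq[OF equiv_presentation_cong]) simp
  finally show ?thesis
    using assms by (intro inv_equality class_closed) (auto simp: words_def one_presented_group)
qed

text \<open>Classes of words are products in the presented group. This turns every question about classes into one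
  about the generators, and each relation into an identity of products.\<close>

lemma class_eq_word_value:
  assumes "w \<in> words S"
  shows "presentation_cong S R `` {w} =
    word_value (presented_group S R) (\<lambda>x. presentation_cong S R `` {[(x, True)]}) w"
  using assms
proof (induction w)
  case (Cons l w)
  obtain x e where l: "l = (x, e)" "x \<in> S" "w \<in> words S"
    using Cons.prems by (cases l) (auto simp: words_def)
  have "presentation_cong S R `` {[l] @ w} =
      presentation_cong S R `` {[l]} \<otimes>\<^bsub>presented_group S R\<^esub> presentation_cong S R `` {w}"
    using l by (intro presented_group_mult[symmetric]) (auto simp: words_def)
  thus ?case
    using Cons.IH l by (simp add: inv_generator_class)
qed (simp add: one_presented_group)

lemma generate_presented_group:
  "generate (presented_group S R) ((\<lambda>x. presentation_cong S R `` {[(x, True)]}) ` S) =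
     carrier (presented_group S R)"
proof -
  let ?G = "presented_group S R" and ?g = "\<lambda>x. presentation_cong S R `` {[(x, True)]}"
  interpret group ?G by (rule group_presented_group)
  have g: "?g ` S \<subseteq> carrier ?G" by (auto simp: words_def intro!: class_closed)
  have "word_value ?G ?g w \<in> generate ?G (?g ` S)" if "w \<in> words S" for w
    using that
  proof (induction w)
    case (Cons l w)
    obtain x e where l: "l = (x, e)" "x \<in> S" "w \<in> words S"
      using Cons.prems by (cases l) (auto simp: words_def)
    hence "?g x \<in> generate ?G (?g ` S)" "inv\<^bsub>?G\<^esub> ?g x \<in> generate ?G (?g ` S)"
      by (intro generate.incl generate.inv imageI; simp)+
    thus ?case
      using Cons.IH l by (cases e) (simp_all add: generate.eng)
  qed (simp add: generate.one)
  hence "carrier ?G \<subseteq> generate ?G (?g ` S)"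
    using class_eq_word_value[of _ S R] by (auto simp: carrier_presented_group)
  thus ?thesis
    using generate_incl[OF g] by blast
qed

lemma word_value_cong:
  "(\<And>x. x \<in> fst ` set w \<Longrightarrow> f x = g x) \<Longrightarrow> word_value G f w = word_value G g w"
  by (induction w) auto

lemma words_simps [simp]:
  "[] \<in> words S" "l # w \<in> words S \<longleftrightarrow> fst l \<in> S \<and> w \<in> words S"
  by (cases l, auto simp: words_def)+

section \<open>Rotations in the braid group of the projective plane\<close>

text \<open>The relations of the braid group, read in an arbitrary group. The families \<open>s\<close> and \<open>r\<close> are total functions
  with values in the carrier at every index; this makes membership unconditional.\<close>

locale rp2_braid_relations = group G for G (structure) +
  fixes n :: nat and s r :: "nat \<Rightarrow> 'a"
  assumes n_ge_2: "n \<ge> 2"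
    and s_closed [simp]: "s i \<in> carrier G"
    and r_closed [simp]: "r i \<in> carrier G"
    and s_far: "\<lbrakk>1 \<le> i; i + 2 \<le> j; j < n\<rbrakk> \<Longrightarrow> s i \<otimes> s j = s j \<otimes> s i"
    and s_braid: "\<lbrakk>1 \<le> i; i + 2 \<le> n\<rbrakk> \<Longrightarrow>
      s i \<otimes> s (Suc i) \<otimes> s i = s (Suc i) \<otimes> s i \<otimes> s (Suc i)"
    and s_r_far: "\<lbrakk>1 \<le> i; i < n; 1 \<le> j; j \<le> n; j \<noteq> i; j \<noteq> Suc i\<rbrakk> \<Longrightarrow> s i \<otimes> r j = r j \<otimes> s i"
    and r_Suc: "\<lbrakk>1 \<le> i; i < n\<rbrakk> \<Longrightarrow> r (Suc i) = inv (s i) \<otimes> r i \<otimes> inv (s i)"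
    and r_comm: "\<lbrakk>1 \<le> i; i < n\<rbrakk> \<Longrightarrow>
      inv (r (Suc i)) \<otimes> inv (r i) \<otimes> r (Suc i) \<otimes> r i = s i \<otimes> s i"
    and r_square: "r 1 \<otimes> r 1 =
      list_prod G (map s [1..<n]) \<otimes> list_prod G (map s (rev [1..<n]))"
begin

text \<open>Rotation of the first \<open>k\<close> strands with one passage through the crosscap.\<close>

definition rot :: "nat \<Rightarrow> 'a" where
  "rot k = r k \<otimes> list_prod G (map s (rev [1..<k]))"

abbreviation a where "a \<equiv> rot n"
abbreviation b where "b \<equiv> rot (n - Suc 0)"
abbreviation (input) "s_prod k \<equiv> list_prod G (map s [1..<k])"
abbreviation (input) "s_rev_prod k \<equiv> list_prod G (map s (rev [1..<k]))"

lemma s_prod_closed [simp]: "list_prod G (map s xs) \<in> carrier G"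
  and r_prod_closed [simp]: "list_prod G (map r xs) \<in> carrier G"
  by (auto intro!: list_prod_closed)

lemma rot_closed [simp]: "rot k \<in> carrier G"
  by (simp add: rot_def)

lemma rot_1: "rot (Suc 0) = r 1"
  by (simp add: rot_def)

lemma rot_Suc:
  assumes "1 \<le> k" "k < n"
  shows "rot (Suc k) = inv (s k) \<otimes> rot k"
proof -
  have "rot (Suc k) = r (Suc k) \<otimes> s k \<otimes> s_rev_prod k"
    using assms by (simp add: rot_def m_assoc)
  also have "r (Suc k) \<otimes> s k = inv (s k) \<otimes> r k"
    using r_Suc[OF assms] by (simp add: m_assoc)
  finally show ?thesis by (simp add: rot_def m_assoc)
qed

lemma rot_eq_s_rot:
  assumes "1 \<le> k" "k < n"
  shows "rot k = s k \<otimes> rot (Suc k)"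
  by (simp add: rot_Suc[OF assms] m_assoc[symmetric])

text \<open>The second form \<open>rot k = (\<sigma>\<^sub>1 \<dots> \<sigma>\<^bsub>k-1\<^esub>)\<^sup>-\<^sup>1 \<rho>\<^sub>1\<close> of the rotation: each \<open>\<sigma>\<^sub>k\<close> cancels against the
  \<open>\<sigma>\<^sub>k\<^sup>-\<^sup>1\<close> by which \<open>rot (k + 1)\<close> differs from \<open>rot k\<close>.\<close>

lemma s_prod_rot:
  assumes "1 \<le> k" "k \<le> n"
  shows "s_prod k \<otimes> rot k = r 1"
  using assms
proof (induction k rule: dec_induct)
  case base
  show ?case by (simp add: rot_1)
next
  case (step k)
  have "s_prod (Suc k) \<otimes> rot (Suc k) = s_prod k \<otimes> (s k \<otimes> rot (Suc k))"
    using step by (simp add: list_prod_append m_assoc image_subset_iff)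
  thus ?case using step rot_eq_s_rot[of k] by simp
qed

text \<open>By the second form only \<open>\<rho>\<^sub>1\<close> and \<open>\<sigma>\<^sub>1, \<dots>, \<sigma>\<^bsub>k-1\<^esub>\<close> occur in \<open>rot k\<close>.\<close>

lemma rot_s_commute:
  assumes "1 \<le> k" "k < i" "i < n"
  shows "rot k \<otimes> s i = s i \<otimes> rot k"
  using assms(1,2)
proof (induction k rule: dec_induct)
  case base
  thus ?case using assms s_r_far[of i 1] by (simp add: rot_1)
next
  case (step k)
  have 1: "inv (s k) \<otimes> s i = s i \<otimes> inv (s k)"
    using s_far[of k i] step assms by (intro inv_intertwine) auto
  have "rot (Suc k) \<otimes> s i = inv (s k) \<otimes> (rot k \<otimes> s i)"
    using step assms by (simp add: rot_Suc m_assoc)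
  also have "\<dots> = inv (s k) \<otimes> s i \<otimes> rot k"
    using step by (simp add: m_assoc)
  finally show ?case using 1 step assms by (simp add: rot_Suc m_assoc)
qed

text \<open>The case \<open>k = i + 2\<close> is the braid relation conjugated into the form
  \<open>\<sigma>\<^bsub>i+1\<^esub>\<^sup>-\<^sup>1 \<sigma>\<^sub>i\<^sup>-\<^sup>1 \<sigma>\<^bsub>i+1\<^esub> = \<sigma>\<^sub>i \<sigma>\<^bsub>i+1\<^esub>\<^sup>-\<^sup>1 \<sigma>\<^sub>i\<^sup>-\<^sup>1\<close>; the further factors of a longer rotation commute with \<open>\<sigma>\<^sub>i\<close>.\<close>

lemma rot_s:
  assumes "1 \<le> i" "Suc i < k" "k \<le> n"
  shows "rot k \<otimes> s (Suc i) = s i \<otimes> rot k"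
proof -
  from assms have "Suc (Suc i) \<le> k" by simp
  thus ?thesis using assms(3)
  proof (induction k rule: dec_induct)
    case base
    let ?x = "s i" and ?y = "s (Suc i)" and ?c = "rot i"
    have rot: "rot (Suc (Suc i)) = inv ?y \<otimes> inv ?x \<otimes> ?c"
      using base assms by (simp add: rot_Suc m_assoc)
    have c: "?c \<otimes> ?y = ?y \<otimes> ?c"
      using rot_s_commute[of i "Suc i"] base assms by simp
    have "inv (?x \<otimes> ?y) \<otimes> ?y = ?x \<otimes> inv (?x \<otimes> ?y)"
      using s_braid[of i] base assms by (intro inv_intertwine) (auto simp: m_assoc)
    hence "inv ?y \<otimes> inv ?x \<otimes> ?y = ?x \<otimes> inv ?y \<otimes> inv ?x"
      by (simp add: inv_mult_group m_assoc)
    thus ?case using c by (simp add: rot m_assoc) (simp add: m_assoc[symmetric])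
  next
    case (step k)
    have 1: "inv (s k) \<otimes> s i = s i \<otimes> inv (s k)"
      using s_far[of i k] step assms by (intro inv_intertwine) auto
    have "rot (Suc k) \<otimes> s (Suc i) = inv (s k) \<otimes> (rot k \<otimes> s (Suc i))"
      using step assms by (simp add: rot_Suc m_assoc)
    also have "\<dots> = inv (s k) \<otimes> s i \<otimes> rot k"
      using step by (simp add: m_assoc)
    finally show ?case using 1 step assms by (simp add: rot_Suc m_assoc)
  qed
qed

text \<open>The shift of \<open>\<rho>\<^sub>2\<close> to \<open>\<rho>\<^sub>1\<close> by \<open>rot 2\<close> is the commutator relation in disguise. Higher indices follow since
  \<open>\<rho>\<^bsub>i+1\<^esub>\<close> is made from \<open>\<rho>\<^sub>i\<close> and \<open>\<sigma>\<^sub>i\<close>, both of which are shifted, and longer rotations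
  differ by factors commuting with \<open>\<rho>\<^sub>i\<close>.\<close>

lemma rot_r:
  assumes "1 \<le> i" "i < k" "k \<le> n"
  shows "rot k \<otimes> r (Suc i) = r i \<otimes> rot k"
proof -
  from assms have "Suc i \<le> k" by simp
  moreover have "rot (Suc i) \<otimes> r (Suc i) = r i \<otimes> rot (Suc i)"
    if "1 \<le> i" "Suc i \<le> n" for i
    using that
  proof (induction i rule: dec_induct)
    case base
    let ?s = "s (Suc 0)" and ?r = "r (Suc 0)" and ?r' = "r (Suc (Suc 0))"
    \<comment> \<open>After elimination of \<open>\<rho>\<^sub>2\<close> the commutator relation reads \<open>\<sigma>\<^sub>1\<^sup>-\<^sup>1 x = x \<sigma>\<^sub>1\<close> for this \<open>x\<close>, and the claim
      is \<open>\<sigma>\<^sub>1\<^sup>-\<^sup>1 x \<sigma>\<^sub>1\<^sup>-\<^sup>1 = x\<close>.\<close>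
    let ?x = "?r \<otimes> inv ?s \<otimes> ?r"
    have r2: "?r' = inv ?s \<otimes> ?r \<otimes> inv ?s"
      using r_Suc[of "Suc 0"] base by simp
    have "?r' \<otimes> ?r = ?r \<otimes> ?r' \<otimes> (inv ?r' \<otimes> inv ?r \<otimes> ?r' \<otimes> ?r)"
      by (simp add: m_assoc)
    also have "\<dots> = ?r \<otimes> ?r' \<otimes> (?s \<otimes> ?s)"
      using r_comm[of "Suc 0"] base by simp
    finally have "inv ?s \<otimes> ?x = ?x \<otimes> ?s"
      unfolding r2 by (simp add: m_assoc)
    hence "inv ?s \<otimes> ?x \<otimes> inv ?s = ?x"
      by (simp add: m_assoc)
    thus ?case
      using base by (simp add: rot_Suc rot_1 r2 m_assoc)
  next
    case (step i)
    have ri: "r (Suc i) = inv (s i) \<otimes> r i \<otimes> inv (s i)"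
      and rSi: "r (Suc (Suc i)) = inv (s (Suc i)) \<otimes> r (Suc i) \<otimes> inv (s (Suc i))"
      using r_Suc[of i] r_Suc[of "Suc i"] step by auto
    let ?c = "rot (Suc (Suc i))"
    have c: "?c \<otimes> inv (s (Suc i)) = inv (s i) \<otimes> ?c"
      using step by (intro intertwine_inv rot_s) auto
    have "inv (s (Suc i)) \<otimes> r i = r i \<otimes> inv (s (Suc i))"
      using step s_r_far[of "Suc i" i] by (intro inv_intertwine) auto
    hence comm: "?c \<otimes> r (Suc i) = r i \<otimes> ?c"
      using step by (simp add: rot_Suc m_assoc) (simp flip: m_assoc)
    have "?c \<otimes> r (Suc (Suc i)) = (?c \<otimes> inv (s (Suc i))) \<otimes> r (Suc i) \<otimes> inv (s (Suc i))"
      by (simp add: rSi m_assoc)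
    also have "\<dots> = inv (s i) \<otimes> (?c \<otimes> r (Suc i)) \<otimes> inv (s (Suc i))"
      by (simp add: c m_assoc)
    also have "\<dots> = inv (s i) \<otimes> r i \<otimes> (?c \<otimes> inv (s (Suc i)))"
      by (simp add: comm m_assoc)
    also have "\<dots> = r (Suc i) \<otimes> ?c"
      by (simp add: c ri m_assoc)
    finally show ?case .
  qed
  ultimately show ?thesis using assms(3)
  proof (induction k rule: dec_induct)
    case base
    thus ?case using assms by simp
  next
    case (step k)
    have 1: "inv (s k) \<otimes> r i = r i \<otimes> inv (s k)"
      using s_r_far[of k i] step assms by (intro inv_intertwine) auto
    have "rot (Suc k) \<otimes> r (Suc i) = inv (s k) \<otimes> (rot k \<otimes> r (Suc i))"
      using step assms by (simp add: rot_Suc m_assoc)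
    also have "\<dots> = inv (s k) \<otimes> r i \<otimes> rot k"
      using step assms by (simp add: m_assoc)
    finally show ?case using 1 step assms by (simp add: rot_Suc m_assoc)
  qed
qed

text \<open>The strand that passes the last place goes through the crosscap, whence the inverse. The proof evaluates
  \<open>a \<rho>\<^sub>1\<close> by the second form of \<open>a\<close> and the value of \<open>\<rho>\<^sub>1\<^sup>2\<close>; what is left is \<open>\<sigma>\<^bsub>n-1\<^esub> \<dots> \<sigma>\<^sub>1 = \<rho>\<^sub>n\<^sup>-\<^sup>1 a\<close>.\<close>

lemma a_r_1: "a \<otimes> r 1 = inv (r n) \<otimes> a"
proof -
  have "s_prod n \<otimes> (a \<otimes> r 1) = s_prod n \<otimes> s_rev_prod n"
    using s_prod_rot[of n] n_ge_2 r_square by (simp flip: m_assoc)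
  hence "a \<otimes> r 1 = s_rev_prod n"
    by simp
  thus ?thesis by (simp add: rot_def)
qed

text \<open>In the induction step \<open>rot k = \<sigma>\<^sub>k rot (k + 1)\<close>, and collecting the factors \<open>rot (k + 1)\<close> of its \<open>k\<close>-th power
  on the right leaves \<open>\<sigma>\<^sub>k \<dots> \<sigma>\<^sub>1\<close>, which \<open>\<rho>\<^bsub>k+1\<^esub>\<close> completes to one more factor \<open>rot (k + 1)\<close>.\<close>

lemma r_rev_prod_eq_rot_pow:
  assumes "1 \<le> k" "k \<le> n"
  shows "list_prod G (map r (rev [1..<Suc k])) = rot k [^] k"
  using assms
proof (induction k rule: dec_induct)
  case base
  show ?case by (simp add: rot_1)
next
  case (step k)
  have "rot k [^] k = (s (k - 0) \<otimes> rot (Suc k)) [^] k"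
    using step by (simp add: rot_eq_s_rot)
  also have "\<dots> = list_prod G (map (\<lambda>j. s (k - j)) [0..<k]) \<otimes> rot (Suc k) [^] k"
  proof (rule pow_mult_intertwined)
    fix j assume "Suc j < k"
    thus "rot (Suc k) \<otimes> s (k - j) = s (k - Suc j) \<otimes> rot (Suc k)"
      using rot_s[of "k - Suc j" "Suc k"] step by (simp add: Suc_diff_Suc)
  qed auto
  also have "map (\<lambda>j. s (k - j)) [0..<k] = map s (rev [1..<Suc k])"
    by (rule nth_equalityI) (auto simp: rev_nth Suc_diff_Suc simp del: upt_Suc)
  finally have "rot k [^] k = s_rev_prod (Suc k) \<otimes> rot (Suc k) [^] k" .
  moreover have "list_prod G (map r (rev [1..<Suc (Suc k)])) =
      r (Suc k) \<otimes> list_prod G (map r (rev [1..<Suc k]))"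
    using step by simp
  ultimately show ?case
    using step nat_pow_Suc2[of "rot (Suc k)" k]
    by (simp del: upt_Suc nat_pow_Suc add: rot_def[of "Suc k"] m_assoc)
qed

text \<open>The first \<open>i - 1\<close> factors \<open>a\<close> move \<open>\<rho>\<^sub>i\<close> down to \<open>\<rho>\<^sub>1\<close>, the next one turns it into \<open>\<rho>\<^sub>n\<^sup>-\<^sup>1\<close>, and the
  remaining \<open>n - i\<close> move this down to \<open>\<rho>\<^sub>i\<^sup>-\<^sup>1\<close>.\<close>

lemma a_pow_r:
  assumes "1 \<le> i" "i \<le> n"
  shows "a [^] n \<otimes> r i = inv (r i) \<otimes> a [^] n"
proof -
  have "a [^] (i - 1) \<otimes> r (i - 0) = r (i - (i - 1)) \<otimes> a [^] (i - 1)"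
  proof (rule intertwine_pow)
    fix j assume "j < i - 1"
    thus "a \<otimes> r (i - j) = r (i - Suc j) \<otimes> a"
      using rot_r[of "i - Suc j" n] assms by (simp add: Suc_diff_Suc)
  qed auto
  hence 1: "a [^] (i - 1) \<otimes> r i = r 1 \<otimes> a [^] (i - 1)"
    using assms by simp
  have "a [^] (n - i) \<otimes> inv (r (n - 0)) = inv (r (n - (n - i))) \<otimes> a [^] (n - i)"
  proof (rule intertwine_pow)
    fix j assume "j < n - i"
    thus "a \<otimes> inv (r (n - j)) = inv (r (n - Suc j)) \<otimes> a"
      using rot_r[of "n - Suc j" n] assms by (intro intertwine_inv) (auto simp: Suc_diff_Suc)
  qed auto
  hence 2: "a [^] (n - i) \<otimes> inv (r n) = inv (r i) \<otimes> a [^] (n - i)"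
    using assms by simp
  have "a [^] n = a [^] (n - i + 1 + (i - 1))"
    using assms by simp
  hence split: "a [^] n = a [^] (n - i) \<otimes> a \<otimes> a [^] (i - 1)"
    by (simp only: nat_pow_mult[symmetric] rot_closed nat_pow_eone m_assoc nat_pow_closed)
  have "a [^] n \<otimes> r i = a [^] (n - i) \<otimes> (a \<otimes> r 1) \<otimes> a [^] (i - 1)"
    by (simp add: split m_assoc 1[simplified])
  also have "\<dots> = (a [^] (n - i) \<otimes> inv (r n)) \<otimes> a \<otimes> a [^] (i - 1)"
    unfolding a_r_1 by (simp add: m_assoc)
  also have "\<dots> = inv (r i) \<otimes> a [^] n"
    unfolding 2 by (simp add: split m_assoc)
  finally show ?thesis .
qed

text \<open>Conjugation by \<open>a\<^sup>n = \<rho>\<^sub>n \<dots> \<rho>\<^sub>1\<close> inverts every \<open>\<rho>\<^sub>i\<close> and fixes \<open>a\<^sup>n\<close>, so that this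
  product does not change when each of its factors is inverted in place.\<close>

lemma a_pow_eq_inv_r_prod: "a [^] n = inv (list_prod G (map r [1..<Suc n]))"
proof -
  have "a [^] n \<otimes> list_prod G (map r (rev [1..<Suc n])) =
      list_prod G (map (\<lambda>i. inv (r i)) (rev [1..<Suc n])) \<otimes> a [^] n"
    by (intro intertwine_list_prod a_pow_r) auto
  moreover have "list_prod G (map (\<lambda>i. inv (r i)) (rev [1..<Suc n])) \<in> carrier G"
    by (auto intro!: list_prod_closed simp del: upt_Suc)
  ultimately have "a [^] n = list_prod G (map (\<lambda>i. inv (r i)) (rev [1..<Suc n]))"
    using r_rev_prod_eq_rot_pow[of n] n_ge_2
    by (simp del: upt_Suc)
  thus ?thesis
    by (subst inv_list_prod) (auto simp: rev_map o_def simp del: upt_Suc)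
qed

text \<open>With \<open>\<sigma>\<^sub>1 \<dots> \<sigma>\<^bsub>n-1\<^esub> = \<rho>\<^sub>1 a\<^sup>-\<^sup>1\<close>, collecting the factors \<open>a\<^sup>-\<^sup>1\<close> gives \<open>\<rho>\<^sub>1 \<dots> \<rho>\<^sub>n a\<^sup>-\<^sup>n\<close>.\<close>

theorem full_twist_eq: "s_prod n [^] n = inv (a [^] (2 * n))"
proof -
  have "s_prod n = r (Suc 0) \<otimes> inv a"
    using s_prod_rot[of n] n_ge_2 by (simp add: inv_solve_right)
  hence "s_prod n [^] n = list_prod G (map (\<lambda>j. r (Suc j)) [0..<n]) \<otimes> inv a [^] n"
    using inv_intertwine[OF _ _ _ rot_r[of _ n]]
    by (simp add: pow_mult_intertwined[of "inv a" "\<lambda>j. r (Suc j)"])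
  also have "map (\<lambda>j. r (Suc j)) [0..<n] = map r [1..<Suc n]"
    by (simp del: upt_Suc flip: map_Suc_upt)
  also have "list_prod G \<dots> = inv (a [^] n)"
    by (simp add: a_pow_eq_inv_r_prod del: upt_Suc)
  finally show ?thesis
    by (simp add: nat_pow_inv mult_2 inv_mult_group flip: nat_pow_mult)
qed

text \<open>Here \<open>a\<^sup>n = \<rho>\<^sub>n b\<^bsup>n-1\<^esup>\<close>, and moving \<open>a\<^sup>n\<close> past \<open>\<rho>\<^sub>n\<close> in \<open>a\<^sup>n \<rho>\<^sub>n b\<^bsup>n-1\<^esup>\<close> makes the two
  \<open>\<rho>\<^sub>n\<close> cancel.\<close>

theorem b_pow_eq: "b [^] (2 * (n - 1)) = a [^] (2 * n)"
proof -
  obtain m where m: "n = Suc m" "1 \<le> m" using n_ge_2 by (cases n) auto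
  hence b: "n - Suc 0 = m" by simp
  have an: "a [^] n = r n \<otimes> b [^] m"
  proof -
    have "a [^] n = list_prod G (map r (rev [1..<Suc n]))"
      using r_rev_prod_eq_rot_pow[of n] n_ge_2 by simp
    also have "\<dots> = r n \<otimes> list_prod G (map r (rev [1..<Suc m]))"
      unfolding m(1) by simp
    also have "\<dots> = r n \<otimes> rot m [^] m"
      using r_rev_prod_eq_rot_pow[of m] m by simp
    finally show ?thesis by (simp add: b)
  qed
  have "a [^] (2 * n) = a [^] n \<otimes> r n \<otimes> b [^] m"
    by (simp add: mult_2 m_assoc flip: nat_pow_mult an)
  also have "\<dots> = inv (r n) \<otimes> (a [^] n \<otimes> b [^] m)"
    using a_pow_r[of n] n_ge_2 by (simp add: m_assoc)
  also have "\<dots> = b [^] (2 * m)"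
    by (simp add: an mult_2 m_assoc flip: nat_pow_mult)
  finally show ?thesis by (simp add: m)
qed

lemma s_eq_b_a: "s (n - 1) = b \<otimes> inv a"
  using rot_eq_s_rot[of "n - 1"] n_ge_2 by (simp add: m_assoc)

text \<open>The element \<open>b a\<^sup>-\<^sup>1 = \<sigma>\<^bsub>n-1\<^esub>\<close> yields all \<open>\<sigma>\<^sub>i\<close> by shifting down; these and \<open>a\<close> give \<open>\<rho>\<^sub>n\<close>, which
  is shifted down in the same way.\<close>

lemma s_r_in_generate:
  assumes "i \<in> {1..n}"
  shows "i < n \<Longrightarrow> s i \<in> generate G {a, b}" "r i \<in> generate G {a, b}"
proof -
  let ?H = "generate G {a, b}"
  interpret H: subgroup ?H G
    by (rule generate_is_subgroup) auto
  have a: "a \<in> ?H" and b: "b \<in> ?H" by (auto intro: generate.incl)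
  have s: "s i \<in> ?H" if "i \<in> {1..<n}" for i
  proof -
    from that have "i \<le> n - 1" by auto
    thus ?thesis
    proof (induction i rule: inc_induct)
      case base
      show ?case unfolding s_eq_b_a by (intro H.m_closed H.m_inv_closed a b)
    next
      case (step j)
      have "s j = a \<otimes> s (Suc j) \<otimes> inv a"
        using step that rot_s[of j n] by (simp add: m_assoc)
      also have "\<dots> \<in> ?H"
        by (intro H.m_closed H.m_inv_closed a step.IH)
      finally show ?case .
    qed
  qed
  thus "i < n \<Longrightarrow> s i \<in> ?H" using assms by simp
  have "s_rev_prod n \<in> ?H"
  proof -
    have "list_prod G (map s xs) \<in> ?H" if "set xs \<subseteq> {1..<n}" for xs
      using that s by (induction xs) auto
    thus ?thesis by simp
  qed
  have rn: "r n \<in> ?H"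
  proof -
    have "r n = a \<otimes> inv (s_rev_prod n)"
      by (simp add: rot_def m_assoc)
    thus ?thesis using a \<open>s_rev_prod n \<in> ?H\<close> by simp
  qed
  from assms have "i \<le> n" by simp
  thus "r i \<in> ?H"
  proof (induction i rule: inc_induct)
    case (step j)
    have "r j = a \<otimes> r (Suc j) \<otimes> inv a"
      using step assms rot_r[of j n] by (simp add: m_assoc)
    also have "\<dots> \<in> ?H"
      by (intro H.m_closed H.m_inv_closed a step.IH)
    finally show ?case .
  qed (rule rn)
qed

end

section \<open>The presented braid group and its signed permutations\<close>

text \<open>The generators as total families of group elements, with the unit at indices that carry no generator.\<close>

definition rp2_s :: "nat \<Rightarrow> nat \<Rightarrow> rp2_gen word set" where
  "rp2_s n i = (if i \<in> {1..<n} then rp2_braid n [sg i] else \<one>\<^bsub>rp2_braid_group n\<^esub>)"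

definition rp2_r :: "nat \<Rightarrow> nat \<Rightarrow> rp2_gen word set" where
  "rp2_r n j = (if j \<in> {1..n} then rp2_braid n [rh j] else \<one>\<^bsub>rp2_braid_group n\<^esub>)"

definition rp2_value :: "(nat \<Rightarrow> 'a) \<Rightarrow> (nat \<Rightarrow> 'a) \<Rightarrow> rp2_gen \<Rightarrow> 'a" where
  "rp2_value x y g = (case g of Sigma_gen i \<Rightarrow> x i | Rho_gen j \<Rightarrow> y j)"

lemma rp2_value_simps [simp]:
  "rp2_value x y (Sigma_gen i) = x i" "rp2_value x y (Rho_gen j) = y j"
  by (simp_all add: rp2_value_def)

lemma rp2_braid_gens_iff [simp]:
  "Sigma_gen i \<in> rp2_braid_gens n \<longleftrightarrow> 1 \<le> i \<and> i < n"
  "Rho_gen j \<in> rp2_braid_gens n \<longleftrightarrow> 1 \<le> j \<and> j \<le> n"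
  by (auto simp: rp2_braid_gens_def)

lemma group_rp2_braid_group: "group (rp2_braid_group n)"
  by (simp add: rp2_braid_group_def group_presented_group)

lemma rp2_braid_closed: "w \<in> words (rp2_braid_gens n) \<Longrightarrow> rp2_braid n w \<in> carrier (rp2_braid_group n)"
  unfolding rp2_braid_def rp2_braid_group_def by (rule class_closed)

lemma rp2_s_closed: "rp2_s n i \<in> carrier (rp2_braid_group n)"
  and rp2_r_closed: "rp2_r n i \<in> carrier (rp2_braid_group n)"
  using group.is_monoid[OF group_rp2_braid_group, of n]
  by (auto simp: rp2_s_def rp2_r_def intro!: rp2_braid_closed monoid.one_closed)

lemma rp2_braid_eq_word_value:
  assumes "w \<in> words (rp2_braid_gens n)"
  shows "rp2_braid n w = word_value (rp2_braid_group n) (rp2_value (rp2_s n) (rp2_r n)) w"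
proof -
  have "rp2_braid n w = word_value (rp2_braid_group n)
      (\<lambda>x. presentation_cong (rp2_braid_gens n) (rp2_braid_rels n) `` {[(x, True)]}) w"
    using assms unfolding rp2_braid_def rp2_braid_group_def by (rule class_eq_word_value)
  also have "\<dots> = word_value (rp2_braid_group n) (rp2_value (rp2_s n) (rp2_r n)) w"
  proof -
    have "presentation_cong (rp2_braid_gens n) (rp2_braid_rels n) `` {[(x, True)]} =
        rp2_value (rp2_s n) (rp2_r n) x" if "x \<in> rp2_braid_gens n" for x
      using that by (cases x) (simp_all add: rp2_s_def rp2_r_def rp2_braid_def)
    moreover have "x \<in> rp2_braid_gens n" if "x \<in> fst ` set w" for x
      using that assms by (auto simp: words_def)
    ultimately show ?thesis
      by (intro word_value_cong) auto
  qed
  finally show ?thesis .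
qed

lemma rp2_braid_relation:
  assumes "(u, v) \<in> rp2_braid_rels n" "u \<in> words (rp2_braid_gens n)" "v \<in> words (rp2_braid_gens n)"
  shows "word_value (rp2_braid_group n) (rp2_value (rp2_s n) (rp2_r n)) u =
    word_value (rp2_braid_group n) (rp2_value (rp2_s n) (rp2_r n)) v"
  using equiv_class_eq[OF equiv_presentation_cong presentation_cong.relation[OF assms]] assms(2,3)
  by (simp flip: rp2_braid_eq_word_value add: rp2_braid_def)

lemma rp2_braid_relations:
  assumes "n \<ge> 2"
  shows "rp2_braid_relations (rp2_braid_group n) n (rp2_s n) (rp2_r n)"
proof -
  interpret group "rp2_braid_group n" by (rule group_rp2_braid_group)
  note [simp] = rp2_s_closed rp2_r_closed
  let ?G = "rp2_braid_group n"
  let ?v = "word_value ?G (rp2_value (rp2_s n) (rp2_r n))"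
  show ?thesis
  proof unfold_locales
    fix i j assume *: "1 \<le> i" "i + 2 \<le> j" "j < n"
    have "?v [sg i, sg j] = ?v [sg j, sg i]"
      using * by (intro rp2_braid_relation) (auto simp: rp2_braid_rels_def)
    thus "rp2_s n i \<otimes>\<^bsub>?G\<^esub> rp2_s n j = rp2_s n j \<otimes>\<^bsub>?G\<^esub> rp2_s n i"
      by (simp add: m_assoc)
  next
    fix i assume *: "1 \<le> i" "i + 2 \<le> n"
    have "?v [sg i, sg (i + 1), sg i] = ?v [sg (i + 1), sg i, sg (i + 1)]"
      using * by (intro rp2_braid_relation) (auto simp: rp2_braid_rels_def)
    thus "rp2_s n i \<otimes>\<^bsub>?G\<^esub> rp2_s n (Suc i) \<otimes>\<^bsub>?G\<^esub> rp2_s n i = rp2_s n (Suc i) \<otimes>\<^bsub>?G\<^esub> rp2_s n i \<otimes>\<^bsub>?G\<^esub> rp2_s n (Suc i)"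
      by (simp add: m_assoc)
  next
    fix i j assume *: "1 \<le> i" "i < n" "1 \<le> j" "j \<le> n" "j \<noteq> i" "j \<noteq> Suc i"
    have "?v [sg i, rh j] = ?v [rh j, sg i]"
      using * by (intro rp2_braid_relation) (auto simp: rp2_braid_rels_def)
    thus "rp2_s n i \<otimes>\<^bsub>?G\<^esub> rp2_r n j = rp2_r n j \<otimes>\<^bsub>?G\<^esub> rp2_s n i"
      by (simp add: m_assoc)
  next
    fix i assume *: "1 \<le> i" "i < n"
    have "?v [rh (i + 1)] = ?v [sg_inv i, rh i, sg_inv i]"
      using * by (intro rp2_braid_relation) (auto simp: rp2_braid_rels_def)
    thus "rp2_r n (Suc i) = inv\<^bsub>?G\<^esub> rp2_s n i \<otimes>\<^bsub>?G\<^esub> rp2_r n i \<otimes>\<^bsub>?G\<^esub> inv\<^bsub>?G\<^esub> rp2_s n i"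
      by (simp add: m_assoc)
  next
    fix i assume *: "1 \<le> i" "i < n"
    have "?v [rh_inv (i + 1), rh_inv i, rh (i + 1), rh i] = ?v [sg i, sg i]"
      using * by (intro rp2_braid_relation) (auto simp: rp2_braid_rels_def)
    thus "inv\<^bsub>?G\<^esub> rp2_r n (Suc i) \<otimes>\<^bsub>?G\<^esub> inv\<^bsub>?G\<^esub> rp2_r n i \<otimes>\<^bsub>?G\<^esub> rp2_r n (Suc i) \<otimes>\<^bsub>?G\<^esub> rp2_r n i = rp2_s n i \<otimes>\<^bsub>?G\<^esub> rp2_s n i"
      by (simp add: m_assoc)
  next
    have "map sg xs \<in> words (rp2_braid_gens n)" if "set xs \<subseteq> {1..<n}" for xs
      using that by (induction xs) auto
    hence words: "map sg [1..<n] @ map sg (rev [1..<n]) \<in> words (rp2_braid_gens n)"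
      by (simp flip: map_append)
    have "?v [rh 1, rh 1] = ?v (map sg [1..<n] @ map sg (rev [1..<n]))"
      using assms words by (intro rp2_braid_relation) (auto simp: rp2_braid_rels_def)
    also have "\<dots> = list_prod ?G (map (rp2_s n) [1..<n]) \<otimes>\<^bsub>?G\<^esub>
        list_prod ?G (map (rp2_s n) (rev [1..<n]))"
      unfolding map_append[symmetric] word_value_map_generators
      by (simp only: rp2_value_simps map_append) (rule list_prod_append; auto)
    finally show "rp2_r n 1 \<otimes>\<^bsub>?G\<^esub> rp2_r n 1 = list_prod ?G (map (rp2_s n) [1..<n]) \<otimes>\<^bsub>?G\<^esub>
        list_prod ?G (map (rp2_s n) (rev [1..<n]))"
      by simp
  qed (use assms in auto)
qed

lemma (in group) list_prod_palindrome:
  assumes "\<And>x. x \<in> set xs \<Longrightarrow> x \<in> carrier G \<and> x \<otimes> x = \<one>"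
  shows "list_prod G (xs @ rev xs) = \<one>"
proof -
  have "inv x = x" if "x \<in> set xs" for x
    using assms[OF that] by (intro inv_equality) auto
  hence "map (m_inv G) (rev xs) = rev xs"
    by (intro map_idI) simp
  hence "list_prod G (rev xs) = inv (list_prod G xs)"
    using assms by (subst inv_list_prod) auto
  thus ?thesis
    using assms by (subst list_prod_append) (auto intro!: r_inv list_prod_closed)
qed

text \<open>For involutions the inverses disappear from the relations, the commutator relation follows from
  commutation, and the product in the last relation is a palindrome, hence trivial.\<close>

lemma rp2_braid_involutive_hom:
  assumes "group H" and closed: "\<And>i. x i \<in> carrier H" "\<And>i. y i \<in> carrier H"
    and invol: "\<And>i. x i \<otimes>\<^bsub>H\<^esub> x i = \<one>\<^bsub>H\<^esub>" "\<And>i. y i \<otimes>\<^bsub>H\<^esub> y i = \<one>\<^bsub>H\<^esub>"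
    and far: "\<And>i j. i + 2 \<le> j \<Longrightarrow> x i \<otimes>\<^bsub>H\<^esub> x j = x j \<otimes>\<^bsub>H\<^esub> x i"
    and braid: "\<And>i. x i \<otimes>\<^bsub>H\<^esub> x (Suc i) \<otimes>\<^bsub>H\<^esub> x i = x (Suc i) \<otimes>\<^bsub>H\<^esub> x i \<otimes>\<^bsub>H\<^esub> x (Suc i)"
    and xy: "\<And>i j. j \<noteq> i \<Longrightarrow> j \<noteq> Suc i \<Longrightarrow> x i \<otimes>\<^bsub>H\<^esub> y j = y j \<otimes>\<^bsub>H\<^esub> x i"
    and conj: "\<And>i. y (Suc i) = x i \<otimes>\<^bsub>H\<^esub> y i \<otimes>\<^bsub>H\<^esub> x i"
    and yy: "\<And>i j. y i \<otimes>\<^bsub>H\<^esub> y j = y j \<otimes>\<^bsub>H\<^esub> y i"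
  shows "\<exists>h \<in> hom (rp2_braid_group n) H.
    (\<forall>i\<in>{1..<n}. h (rp2_s n i) = x i) \<and> (\<forall>j\<in>{1..n}. h (rp2_r n j) = y j)"
proof -
  interpret H: group H by fact
  note [simp] = closed
  have inv: "inv\<^bsub>H\<^esub> x i = x i" "inv\<^bsub>H\<^esub> y i = y i" for i
    using invol by (auto intro: H.inv_equality)
  let ?f = "rp2_value x y"
  have f: "?f \<in> rp2_braid_gens n \<rightarrow> carrier H"
    by (auto simp: rp2_value_def split: rp2_gen.split)
  have rel: "word_value H ?f u = word_value H ?f v" if "(u, v) \<in> rp2_braid_rels n" for u v
  proof -
    have far': "x i \<otimes>\<^bsub>H\<^esub> x j = x j \<otimes>\<^bsub>H\<^esub> x i" if "i + 2 \<le> j \<or> j + 2 \<le> i" for i j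
      using that far by metis
    have yyyy: "y (Suc i) \<otimes>\<^bsub>H\<^esub> (y i \<otimes>\<^bsub>H\<^esub> (y (Suc i) \<otimes>\<^bsub>H\<^esub> y i)) = \<one>\<^bsub>H\<^esub>" for i
    proof -
      have "y (Suc i) \<otimes>\<^bsub>H\<^esub> (y i \<otimes>\<^bsub>H\<^esub> (y (Suc i) \<otimes>\<^bsub>H\<^esub> y i)) =
          y (Suc i) \<otimes>\<^bsub>H\<^esub> (y i \<otimes>\<^bsub>H\<^esub> (y i \<otimes>\<^bsub>H\<^esub> y (Suc i)))"
        by (simp only: yy[of "Suc i" i])
      thus ?thesis by (simp add: invol flip: H.m_assoc[of "y i" "y i"])
    qed
    have conj': "x i \<otimes>\<^bsub>H\<^esub> (y i \<otimes>\<^bsub>H\<^esub> x i) = y (Suc i)" for i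
      by (simp add: conj H.m_assoc)
    have last: "word_value H ?f (map sg [1..<n] @ map sg (rev [1..<n])) = \<one>\<^bsub>H\<^esub>"
    proof -
      have "list_prod H (map x [1..<n] @ rev (map x [1..<n])) = \<one>\<^bsub>H\<^esub>"
        by (rule H.list_prod_palindrome) (auto simp: invol)
      thus ?thesis
        unfolding map_append[symmetric] word_value_map_generators by (simp add: rev_map)
    qed
    from that consider
      (far) i j where "u = [sg i, sg j]" "v = [sg j, sg i]" "i + 2 \<le> j \<or> j + 2 \<le> i"
      | (braid) i where "u = [sg i, sg (i + 1), sg i]" "v = [sg (i + 1), sg i, sg (i + 1)]"
      | (mixed) i j where "u = [sg i, rh j]" "v = [rh j, sg i]" "j \<noteq> i" "j \<noteq> Suc i"
      | (conj) i where "u = [rh (i + 1)]" "v = [sg_inv i, rh i, sg_inv i]"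
      | (comm) i where "u = [rh_inv (i + 1), rh_inv i, rh (i + 1), rh i]" "v = [sg i, sg i]"
      | (square) "u = [rh 1, rh 1]" "v = map sg [1..<n] @ map sg (rev [1..<n])"
      unfolding rp2_braid_rels_def by (elim UnE; fastforce)
    thus ?thesis
    proof cases
      case far
      thus ?thesis using far' by simp
    next
      case braid
      thus ?thesis using assms(7) by (simp add: H.m_assoc)
    next
      case mixed
      thus ?thesis using xy by simp
    next
      case conj
      thus ?thesis by (simp add: inv conj')
    next
      case comm
      thus ?thesis using yyyy invol by (simp add: inv)
    next
      case square
      thus ?thesis using last invol by simp
    qed
  qed
  obtain h where h: "h \<in> hom (rp2_braid_group n) H"
    "\<forall>w \<in> words (rp2_braid_gens n). h (rp2_braid n w) = word_value H ?f w"
    using presented_group_universal[OF \<open>group H\<close> f rel]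
    unfolding rp2_braid_group_def rp2_braid_def by blast
  have "h (rp2_s n i) = x i" if "i \<in> {1..<n}" for i
    using that h(2)[rule_format, of "[sg i]"] by (auto simp: rp2_s_def)
  moreover have "h (rp2_r n j) = y j" if "j \<in> {1..n}" for j
    using that h(2)[rule_format, of "[rh j]"] by (auto simp: rp2_r_def)
  ultimately show ?thesis using h(1) by blast
qed


text \<open>On all of a type the extensionality built into the group of bijections is vacuous.\<close>

lemma bij_group_UNIV [simp]:
  "carrier (BijGroup UNIV) = {f. bij f}" "\<one>\<^bsub>BijGroup UNIV\<^esub> = id"
  "bij f \<Longrightarrow> bij g \<Longrightarrow> f \<otimes>\<^bsub>BijGroup UNIV\<^esub> g = f \<circ> g"
  by (auto simp: BijGroup_def Bij_def compose_def fun_eq_iff)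

lemma bij_group_pow: "bij f \<Longrightarrow> f [^]\<^bsub>BijGroup UNIV\<^esub> (m::nat) = f ^^ m"
proof (induction m)
  case (Suc m)
  have "bij (f ^^ m)" using Suc.prems by (induction m) (auto intro: bij_comp)
  thus ?case using Suc by (simp add: funpow_Suc_right del: funpow.simps)
qed simp

text \<open>Signed permutations act on pairs of a point and a sign.\<close>

definition swap_points :: "nat \<Rightarrow> nat \<times> bool \<Rightarrow> nat \<times> bool" where
  "swap_points i = (\<lambda>(j, e). (Transposition.transpose i (Suc i) j, e))"

definition flip_sign :: "nat \<Rightarrow> nat \<times> bool \<Rightarrow> nat \<times> bool" where
  "flip_sign i = (\<lambda>(j, e). (j, e \<noteq> (j = i)))"

lemma swap_flip_invol [simp]: "swap_points i \<circ> swap_points i = id" "flip_sign i \<circ> flip_sign i = id"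
  by (auto simp: swap_points_def flip_sign_def fun_eq_iff)

lemma swap_flip_bij [simp]: "bij (swap_points i)" "bij (flip_sign i)"
  using o_bij[OF swap_flip_invol(1) swap_flip_invol(1)] o_bij[OF swap_flip_invol(2) swap_flip_invol(2)]
  by auto

lemma signed_permutation_hom:
  "\<exists>h \<in> hom (rp2_braid_group n) (BijGroup UNIV).
    (\<forall>i\<in>{1..<n}. h (rp2_s n i) = swap_points i) \<and> (\<forall>j\<in>{1..n}. h (rp2_r n j) = flip_sign j)"
  by (rule rp2_braid_involutive_hom)
     (simp_all add: group_BijGroup bij_comp,
      auto simp: fun_eq_iff swap_points_def flip_sign_def Transposition.transpose_def)

lemma parity_hom:
  defines "V \<equiv> integer_mod_group 2 \<times>\<times> integer_mod_group 2"
  shows "\<exists>h \<in> hom (rp2_braid_group n) V.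
    (\<forall>i\<in>{1..<n}. h (rp2_s n i) = (1, 0)) \<and> (\<forall>j\<in>{1..n}. h (rp2_r n j) = (0, 1))"
  by (rule rp2_braid_involutive_hom)
     (auto simp: V_def DirProd_group carrier_integer_mod_group)

lemma cycle_swap_points:
  assumes "1 \<le> k"
  shows "foldr (\<circ>) (map swap_points (rev [1..<k])) id (j, e) =
    (if j = 1 then k else if 2 \<le> j \<and> j \<le> k then j - 1 else j, e)"
  using assms
proof (induction k rule: dec_induct)
  case (step k)
  have "[1..<Suc k] = [1..<k] @ [k]" using step by simp
  thus ?case using step by (auto simp: swap_points_def Transposition.transpose_def simp del: upt_Suc)
qed auto

text \<open>The orbit of \<open>(k, True)\<close> descends through all points, returns to \<open>k\<close> with the opposite sign after \<open>k\<close>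
  steps, and closes up after \<open>2k\<close> steps.\<close>

lemma signed_cycle_orbit:
  assumes k: "1 \<le> k" and A: "\<And>j e. A (j, e) = (if j = 1 then (k, \<not> e) else if 2 \<le> j \<and> j \<le> k then (j - 1, e) else (j, e))"
    and m: "(A ^^ m) (k, True) = (k, True)"
  shows "2 * k dvd m"
proof -
  have low: "(A ^^ i) (k, e) = (k - i, e)" if "i < k" for i e
    using that by (induction i) (auto simp: A)
  have high: "(A ^^ (k + i)) (k, e) = (A ^^ i) (k, \<not> e)" for i e
  proof -
    obtain l where l: "k = Suc l" using k by (cases k) auto
    have "(A ^^ k) (k, e) = A ((A ^^ l) (k, e))" by (simp add: l)
    also have "\<dots> = (k, \<not> e)" using low[of l e] l by (simp add: A)
    finally have "(A ^^ k) (k, e) = (k, \<not> e)" .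
    thus ?thesis by (simp add: add.commute[of k] funpow_add)
  qed
  have "(A ^^ (2 * k)) (k, True) = (k, True)"
    using high[of k True] high[of 0 False] by (simp add: mult_2)
  hence "(A ^^ (m mod (2 * k))) (k, True) = (k, True)"
    using m by (simp add: funpow_mod_eq)
  moreover have "(A ^^ i) (k, True) \<noteq> (k, True)" if "0 < i" "i < 2 * k" for i
  proof (cases "i < k")
    case True
    thus ?thesis using low[of i True] that by auto
  next
    case False
    thus ?thesis using high[of "i - k" True] low[of "i - k" False] that by auto
  qed
  moreover have "m mod (2 * k) < 2 * k" using k by simp
  ultimately have "m mod (2 * k) = 0" by blast
  thus ?thesis by blast
qed

lemma list_prod_bij_group:
  assumes "\<And>f. f \<in> set fs \<Longrightarrow> bij f"
  shows "list_prod (BijGroup UNIV) fs = foldr (\<circ>) fs id \<and> bij (foldr (\<circ>) fs id)"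
  using assms
proof (induction fs)
  case (Cons f fs)
  have "list_prod (BijGroup UNIV) fs = foldr (\<circ>) fs id \<and> bij (foldr (\<circ>) fs id)"
    by (rule Cons.IH) (rule Cons.prems, simp)
  moreover have "bij f" by (rule Cons.prems) simp
  ultimately have "list_prod (BijGroup UNIV) fs = foldr (\<circ>) fs id" "bij (foldr (\<circ>) fs id)" "bij f"
    by (iprover dest: conjunct1 conjunct2)+
  moreover have "foldr (\<circ>) (f # fs) id = f \<circ> foldr (\<circ>) fs id" by simp
  ultimately show ?case
    unfolding list_prod_Cons
    by (intro conjI) (simp_all only: bij_group_UNIV bij_comp)
qed simp

section \<open>Groups generated by two rotations\<close>

text \<open>What the conclusions need to know about the quotient of the braid group. It is phrased without reference to
  braids, so that it is invariant under isomorphism. The last two conditions come from \<open>\<sigma>\<^bsub>n-1\<^esub> = b a\<^sup>-\<^sup>1\<close>, whose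
  square is a commutator, and from the parities of the numbers of letters \<open>\<sigma>\<close> and \<open>\<rho>\<close>.\<close>

locale rotation_generated_group = group G for G (structure) +
  fixes n :: nat and a b :: 'a
  assumes n_ge_2: "n \<ge> 2"
    and a_closed: "a \<in> carrier G" and b_closed: "b \<in> carrier G"
    and generators: "generate G {a, b} = carrier G"
    and ord_a: "ord a = 2 * n" and ord_b: "ord b = 2 * (n - 1)"
    and commutator: "\<exists>x\<in>carrier G. \<exists>y\<in>carrier G.
      (b \<otimes> inv a) \<otimes> (b \<otimes> inv a) = inv x \<otimes> inv y \<otimes> x \<otimes> y"
    and klein_hom: "\<exists>h\<in>hom G (integer_mod_group 2 \<times>\<times> integer_mod_group 2).
      \<exists>g\<in>carrier G. \<exists>g'\<in>carrier G. h g = (1, 0) \<and> h g' = (0, 1)"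
begin

lemma normal_closure_proper:
  assumes "x \<in> carrier G"
  shows "normal_closure G {x} \<noteq> carrier G"
proof -
  let ?V = "integer_mod_group 2 \<times>\<times> integer_mod_group 2"
  obtain h g g' where h: "h \<in> hom G ?V" "g \<in> carrier G" "g' \<in> carrier G" "h g = (1, 0)" "h g' = (0, 1)"
    using klein_hom by blast
  show ?thesis
  proof (rule singleton_normal_closure_proper[OF _ h(1) _ h(2,3) _ _ _ assms])
    show "comm_group ?V"
      by (intro group.group_comm_groupI DirProd_group) (auto simp: add.commute)
    show "v \<otimes>\<^bsub>?V\<^esub> v = \<one>\<^bsub>?V\<^esub>" if "v \<in> carrier ?V" for v
      using that by (auto simp: mult_2[symmetric])
  qed (simp_all add: h)
qed

text \<open>Ranks are at most 2 because of \<open>a\<close> and \<open>b\<close>, which are of finite order. They are at least 2 because a set with at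
  most one element has a proper normal closure, and generating sets are normally generating.\<close>

theorem conclusions:
  "group G \<and> a \<in> carrier G \<and> b \<in> carrier G \<and>
   generate G {a, b} = carrier G \<and> ord a = 2 * n \<and> ord b = 2 * (n - 1) \<and>
   gen_rank G = 2 \<and> torsion_gen_rank G = 2 \<and>
   (\<forall>x\<in>carrier G. subgroup (normal_closure G {x}) G \<and> normal_closure G {x} \<noteq> carrier G) \<and>
   torsion_normal_gen_rank G = 2 \<and> normal_gen_rank G = 2 \<and>
   (\<forall>k. \<not> strongly_torsion_generated k G) \<and>
   G Mod normal_closure G {a} \<cong> integer_mod_group 2 \<and>
   G Mod normal_closure G {b} \<cong> integer_mod_group 2"
proof -
  note ab = a_closed b_closed and gen = generators and ord = ord_a ord_b and n = n_ge_2
    and proper = normal_closure_proper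
  have lower: "2 \<le> card A"
    if A: "A \<subseteq> carrier G" "finite A" "normal_closure G A = carrier G" for A
  proof (rule ccontr)
    assume "\<not> 2 \<le> card A"
    hence "card A \<le> Suc 0" by simp
    then obtain z where z: "z \<in> carrier G" "A \<subseteq> {z}"
      using A(1,2) by (metis card_le_Suc0_iff_eq empty_subsetI insertI1 one_closed subsetI singletonI subset_eq)
    have "carrier G \<subseteq> normal_closure G {z}"
      using normal_closure_mono[OF z(2)] A(3) by simp
    moreover have "normal_closure G {z} \<subseteq> carrier G"
      using z normal_closure_normal[of "{z}"] normal_imp_subgroup subgroup.subset by blast
    ultimately show False using proper[OF z(1)] by simp
  qed
  have normal: "normal_closure G A = carrier G"
    if "A \<subseteq> carrier G" "generate G A = carrier G" for A
    using that generate_subset_normal_closure normal_closure_normal[of A] normal_imp_subgroup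
      subgroup.subset by blast
  have tors: "{a, b} \<subseteq> torsion_elements G"
  proof -
    have "a [^] (2 * n) = \<one>" "b [^] (2 * (n - 1)) = \<one>"
      using ab pow_ord_eq_1[of a] pow_ord_eq_1[of b] by (simp_all only: ord)
    moreover have "2 * n > 0" "2 * (n - 1) > 0" using n by auto
    ultimately show ?thesis using ab unfolding torsion_elements_def by blast
  qed
  have tors_carrier: "torsion_elements G \<subseteq> carrier G" by (auto simp: torsion_elements_def)
  have rank: "(INF A \<in> \<A>. enat (card A)) = 2"
    if "\<And>A. A \<in> \<A> \<Longrightarrow> 2 \<le> card A" "{a, b} \<in> \<A>" for \<A> :: "'a set set"
  proof (rule antisym)
    have "(INF A \<in> \<A>. enat (card A)) \<le> enat (card {a, b})"
      using that(2) by (rule INF_lower)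
    also have "\<dots> \<le> enat 2" by (simp add: card_insert_if)
    finally show "(INF A \<in> \<A>. enat (card A)) \<le> 2" by (simp add: numeral_eq_enat)
    show "2 \<le> (INF A \<in> \<A>. enat (card A))"
      by (intro INF_greatest) (simp add: numeral_eq_enat that(1))
  qed
  have "gen_rank G = 2"
    unfolding gen_rank_def using ab gen lower normal by (intro rank) auto
  moreover have "torsion_gen_rank G = 2"
    unfolding torsion_gen_rank_def using ab gen lower normal tors tors_carrier by (intro rank) auto
  moreover have "torsion_normal_gen_rank G = 2"
    unfolding torsion_normal_gen_rank_def
    using ab gen lower normal tors tors_carrier by (intro rank) auto
  moreover have "normal_gen_rank G = 2"
    unfolding normal_gen_rank_def using ab gen lower normal by (intro rank) auto
  moreover have "\<not> strongly_torsion_generated k G" for k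
    using proper by (auto simp: strongly_torsion_generated_def)
  moreover have "subgroup (normal_closure G {z}) G" if "z \<in> carrier G" for z
    using that by (intro normal_imp_subgroup normal_closure_normal) simp
  moreover have "G Mod normal_closure G {c} \<cong> integer_mod_group 2" if "c \<in> {a, b}" for c
  proof -
    obtain x y where xy: "x \<in> carrier G" "y \<in> carrier G"
      "(b \<otimes> inv a) \<otimes> (b \<otimes> inv a) = inv x \<otimes> inv y \<otimes> x \<otimes> y"
      using commutator by blast
    have "normal_closure G {c} \<noteq> carrier G" using that ab by (intro proper) auto
    thus ?thesis by (rule quotient_by_generator_order_2[OF ab xy gen that])
  qed
  ultimately show ?thesis
    using is_group ab gen ord proper by simp
qed

lemma iso_image:
  assumes phi: "\<phi> \<in> iso G H" and "group H"
  shows "rotation_generated_group H n (\<phi> a) (\<phi> b)"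
proof -
  interpret H: group H by fact
  interpret phi: group_hom G H \<phi>
    using phi by unfold_locales (simp add: iso_def)
  have bij: "bij_betw \<phi> (carrier G) (carrier H)"
    using phi by (simp add: iso_def)
  have img: "\<phi> ` carrier G = carrier H"
    using bij by (rule bij_betw_imp_surj_on)
  have inj: "\<phi> x = \<phi> y \<longleftrightarrow> x = y" if "x \<in> carrier G" "y \<in> carrier G" for x y
    using that bij by (meson bij_betw_def inj_on_eq_iff)
  have ord: "H.ord (\<phi> x) = ord x" if "x \<in> carrier G" for x
  proof -
    have "\<phi> x [^]\<^bsub>H\<^esub> m = \<one>\<^bsub>H\<^esub> \<longleftrightarrow> ord x dvd m" for m :: nat
      using inj[of "x [^] m" \<one>] that by (simp add: phi.hom_nat_pow pow_eq_id)
    thus ?thesis using that by (simp add: H.ord_unique)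
  qed
  show ?thesis
  proof unfold_locales
    show "generate H {\<phi> a, \<phi> b} = carrier H"
      using phi.generate_img[of "{a, b}"] a_closed b_closed generators img by simp
    obtain x y where xy: "x \<in> carrier G" "y \<in> carrier G"
      "(b \<otimes> inv a) \<otimes> (b \<otimes> inv a) = inv x \<otimes> inv y \<otimes> x \<otimes> y"
      using commutator by blast
    have "(\<phi> b \<otimes>\<^bsub>H\<^esub> inv\<^bsub>H\<^esub> \<phi> a) \<otimes>\<^bsub>H\<^esub> (\<phi> b \<otimes>\<^bsub>H\<^esub> inv\<^bsub>H\<^esub> \<phi> a) =
        \<phi> ((b \<otimes> inv a) \<otimes> (b \<otimes> inv a))"
      using a_closed b_closed by simp
    also have "\<dots> = inv\<^bsub>H\<^esub> \<phi> x \<otimes>\<^bsub>H\<^esub> inv\<^bsub>H\<^esub> \<phi> y \<otimes>\<^bsub>H\<^esub> \<phi> x \<otimes>\<^bsub>H\<^esub> \<phi> y"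
      unfolding xy(3) using xy(1,2) by simp
    finally show "\<exists>x\<in>carrier H. \<exists>y\<in>carrier H. (\<phi> b \<otimes>\<^bsub>H\<^esub> inv\<^bsub>H\<^esub> \<phi> a) \<otimes>\<^bsub>H\<^esub> (\<phi> b \<otimes>\<^bsub>H\<^esub> inv\<^bsub>H\<^esub> \<phi> a)
        = inv\<^bsub>H\<^esub> x \<otimes>\<^bsub>H\<^esub> inv\<^bsub>H\<^esub> y \<otimes>\<^bsub>H\<^esub> x \<otimes>\<^bsub>H\<^esub> y"
      using phi.hom_closed[OF xy(1)] phi.hom_closed[OF xy(2)] by blast
    obtain h g g' where h: "h \<in> hom G (integer_mod_group 2 \<times>\<times> integer_mod_group 2)"
      "g \<in> carrier G" "g' \<in> carrier G" "h g = (1, 0)" "h g' = (0, 1)"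
      using klein_hom by blast
    have psi: "inv_into (carrier G) \<phi> (\<phi> x) = x" if "x \<in> carrier G" for x
      using that bij by (simp add: bij_betw_def)
    have "h \<circ> inv_into (carrier G) \<phi> \<in> hom H (integer_mod_group 2 \<times>\<times> integer_mod_group 2)"
      using Group.hom_compose[OF _ h(1)] iso_set_sym[OF phi] by (auto simp: iso_def)
    thus "\<exists>h\<in>hom H (integer_mod_group 2 \<times>\<times> integer_mod_group 2).
      \<exists>g\<in>carrier H. \<exists>g'\<in>carrier H. h g = (1, 0) \<and> h g' = (0, 1)"
      using h psi by (intro bexI[of _ "h \<circ> inv_into (carrier G) \<phi>"] bexI[of _ "\<phi> g"] bexI[of _ "\<phi> g'"]) auto
  qed (use a_closed b_closed ord ord_a ord_b n_ge_2 in auto)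
qed

end

section \<open>The quotient by the full twist\<close>

text \<open>The full twist is the inverse of \<open>a\<^bsup>2n\<^esup>\<close> and of \<open>b\<^bsup>2(n-1)\<^esup>\<close>, so that it commutes with both
  generators. Being the inverse of a square, it also dies in a group of exponent 2; therefore the parities survive in the
  quotient. The action on signed points bounds the orders from below already in the braid group.\<close>

theorem rotation_generated_rp2_braid_mod_twist:
  assumes n: "n \<ge> 2"
  shows "rotation_generated_group (rp2_braid_mod_twist n) n (twist_class n (braid_a n)) (twist_class n (braid_b n))"
proof -
  let ?B = "rp2_braid_group n"
  interpret rp2_braid_relations ?B n "rp2_s n" "rp2_r n"
    using n by (rule rp2_braid_relations)
  have words: "map sg xs \<in> words (rp2_braid_gens n)" if "set xs \<subseteq> {1..<n}" for xs
    using that by (induction xs) auto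
  have rot: "rp2_braid n (rh k # map sg (rev [1..<k])) = rot k" if "1 \<le> k" "k \<le> n" for k
    using that words[of "rev [1..<k]"]
    by (subst rp2_braid_eq_word_value)
       (auto simp: word_value_map_generators rot_def simp del: rev_map map_map)
  have a: "braid_a n = a" and b: "braid_b n = b"
    using n rot[of n] rot[of "n - 1"] by (simp_all add: braid_a_def braid_b_def)
  have twist: "full_twist n = inv\<^bsub>?B\<^esub> (a [^]\<^bsub>?B\<^esub> (2 * n))"
    using words[of "[1..<n]"] unfolding full_twist_eq[symmetric] full_twist_def
    by (subst rp2_braid_eq_word_value) (simp_all add: word_value_map_generators)
  have gen: "generate ?B {a, b} = carrier ?B"
  proof
    show "generate ?B {a, b} \<subseteq> carrier ?B" by (intro generate_incl) auto
    let ?g = "\<lambda>x. presentation_cong (rp2_braid_gens n) (rp2_braid_rels n) `` {[(x, True)]}"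
    have "?g ` rp2_braid_gens n \<subseteq> generate ?B {a, b}"
    proof clarify
      fix x assume "x \<in> rp2_braid_gens n"
      hence "?g x = (case x of Sigma_gen i \<Rightarrow> rp2_s n i | Rho_gen j \<Rightarrow> rp2_r n j) \<and>
          (case x of Sigma_gen i \<Rightarrow> i \<in> {1..n} \<and> i < n | Rho_gen j \<Rightarrow> j \<in> {1..n})"
        by (cases x) (simp_all add: rp2_s_def rp2_r_def rp2_braid_def)
      thus "?g x \<in> generate ?B {a, b}"
        using s_r_in_generate by (cases x) simp_all
    qed
    hence "generate ?B (?g ` rp2_braid_gens n) \<subseteq> generate ?B {a, b}"
      by (intro generate_subgroup_incl generate_is_subgroup) auto
    thus "carrier ?B \<subseteq> generate ?B {a, b}"
      using generate_presented_group[of "rp2_braid_gens n" "rp2_braid_rels n"]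
      by (simp add: rp2_braid_group_def)
  qed
  let ?z = "full_twist n"
  have z: "?z \<in> carrier ?B" by (simp add: twist)
  have twist_b: "?z = inv\<^bsub>?B\<^esub> (b [^]\<^bsub>?B\<^esub> (2 * (n - 1)))"
    by (simp only: twist b_pow_eq)
  have commute_inv_pow: "x \<otimes>\<^bsub>?B\<^esub> inv\<^bsub>?B\<^esub> (x [^]\<^bsub>?B\<^esub> m) = inv\<^bsub>?B\<^esub> (x [^]\<^bsub>?B\<^esub> m) \<otimes>\<^bsub>?B\<^esub> x"
    if "x \<in> carrier ?B" for x and m :: nat
    using that nat_pow_Suc2[OF that, of m] by (intro intertwine_inv) simp_all
  let ?N = "generate ?B {?z}"
  have N: "?N \<lhd> ?B"
  proof (rule generate_central_normal[OF z _ _ gen])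
    show "a \<otimes>\<^bsub>?B\<^esub> ?z = ?z \<otimes>\<^bsub>?B\<^esub> a" unfolding twist by (rule commute_inv_pow) simp
    show "b \<otimes>\<^bsub>?B\<^esub> ?z = ?z \<otimes>\<^bsub>?B\<^esub> b" unfolding twist_b by (rule commute_inv_pow) simp
  qed auto
  define M where "M = ?B Mod ?N"
  define p where "p = (\<lambda>x. ?N #>\<^bsub>?B\<^esub> x)"
  have p_hom: "p \<in> hom ?B M"
    unfolding p_def M_def using N by (rule normal.r_coset_hom_Mod)
  have car: "carrier M = p ` carrier ?B"
    unfolding p_def M_def by (rule carrier_FactGroup)
  interpret M: group M unfolding M_def using N by (rule normal.factorgroup_is_group)
  interpret p: group_hom ?B M p using p_hom by unfold_locales
  obtain h where h: "h \<in> hom ?B (BijGroup UNIV)"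
    "\<And>i. i \<in> {1..<n} \<Longrightarrow> h (rp2_s n i) = swap_points i"
    "\<And>j. j \<in> {1..n} \<Longrightarrow> h (rp2_r n j) = flip_sign j"
    using signed_permutation_hom[of n] by blast
  interpret h: group_hom ?B "BijGroup UNIV" h
    using h(1) group_BijGroup by (intro group_hom.intro group_hom_axioms.intro is_group)
  have dvd: "2 * k dvd ord (rot k)" if k: "1 \<le> k" "k \<le> n" for k
  proof (rule signed_cycle_orbit[OF k(1)])
    let ?c = "foldr (\<circ>) (map swap_points (rev [1..<k])) id"
    have c_bij: "list_prod (BijGroup UNIV) (map swap_points (rev [1..<k])) = ?c \<and> bij ?c"
      by (rule list_prod_bij_group) auto
    have "h (list_prod ?B (map (rp2_s n) (rev [1..<k]))) =
        list_prod (BijGroup UNIV) (map h (map (rp2_s n) (rev [1..<k])))"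
      by (rule h.hom_list_prod) auto
    also have "map h (map (rp2_s n) (rev [1..<k])) = map swap_points (rev [1..<k])"
      using k h(2) by simp
    also have "list_prod (BijGroup UNIV) \<dots> = ?c"
      using c_bij by (rule conjunct1)
    finally have A: "h (rot k) = flip_sign k \<circ> ?c"
      using k h(3)[of k] c_bij by (simp add: rot_def)
    show "h (rot k) (j, e) = (if j = 1 then (k, \<not> e) else if 2 \<le> j \<and> j \<le> k then (j - 1, e) else (j, e))"
      for j e
      unfolding A o_apply cycle_swap_points[OF k(1)] using k(1) by (auto simp: flip_sign_def)
    have "bij (h (rot k))" using h.hom_closed[of "rot k"] by simp
    hence "h (rot k) ^^ ord (rot k) = h (rot k [^]\<^bsub>?B\<^esub> ord (rot k))"
      by (simp only: h.hom_nat_pow[OF rot_closed] bij_group_pow)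
    thus "(h (rot k) ^^ ord (rot k)) (k, True) = (k, True)"
      by (simp only: pow_ord_eq_1[OF rot_closed] h.hom_one bij_group_UNIV id_apply)
  qed
  let ?V = "integer_mod_group 2 \<times>\<times> integer_mod_group 2"
  obtain q where q: "q \<in> hom ?B ?V"
    "\<And>i. i \<in> {1..<n} \<Longrightarrow> q (rp2_s n i) = (1, 0)" "\<And>j. j \<in> {1..n} \<Longrightarrow> q (rp2_r n j) = (0, 1)"
    using parity_hom[of n] by blast
  have V: "group ?V" by (intro DirProd_group) auto
  interpret q: group_hom ?B ?V q
    using q(1) V by (intro group_hom.intro group_hom_axioms.intro is_group)
  have "q ?z = \<one>\<^bsub>?V\<^esub>"
  proof -
    have "v [^]\<^bsub>?V\<^esub> (2::nat) = \<one>\<^bsub>?V\<^esub>" if "v \<in> carrier ?V" for v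
      using that by (auto simp: numeral_2_eq_2 monoid.nat_pow_Suc[OF group.is_monoid[OF V]] monoid.nat_pow_0[OF group.is_monoid[OF V]] carrier_integer_mod_group)
    hence "q (a [^]\<^bsub>?B\<^esub> (2 * n)) = \<one>\<^bsub>?V\<^esub>"
      using q.hom_closed[OF rot_closed] by (simp add: q.hom_nat_pow q.H.nat_pow_pow[symmetric] del: one_DirProd)
    thus ?thesis unfolding twist by (simp del: one_DirProd inv_DirProd)
  qed
  hence "?N \<subseteq> kernel ?B ?V q"
    using z by (intro generate_subgroup_incl q.subgroup_kernel) (simp add: kernel_def)
  hence "q x = \<one>\<^bsub>?V\<^esub>" if "x \<in> ?N" for x
    using that by (auto simp: kernel_def)
  then obtain k where k: "k \<in> hom M ?V" "\<And>x. x \<in> carrier ?B \<Longrightarrow> k (p x) = q x"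
    using q.hom_FactGroup[OF N] unfolding M_def p_def by blast
  have tc: "twist_class n x = p x" for x by (simp add: twist_class_def p_def)
  have "rotation_generated_group M n (p a) (p b)"
  proof unfold_locales
    show "generate M {p a, p b} = carrier M"
      using p.generate_img[of "{a, b}"] gen car by simp
    show "M.ord (p a) = 2 * n"
      unfolding M_def p_def using dvd[of n] n by (intro ord_quotient_by_power twist N) auto
    show "M.ord (p b) = 2 * (n - 1)"
      unfolding M_def p_def using dvd[of "n - 1"] n by (intro ord_quotient_by_power twist_b N) auto
    have "b \<otimes>\<^bsub>?B\<^esub> inv\<^bsub>?B\<^esub> a = rp2_s n (n - 1)" by (simp only: s_eq_b_a)
    hence "(b \<otimes>\<^bsub>?B\<^esub> inv\<^bsub>?B\<^esub> a) \<otimes>\<^bsub>?B\<^esub> (b \<otimes>\<^bsub>?B\<^esub> inv\<^bsub>?B\<^esub> a) =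
        inv\<^bsub>?B\<^esub> (rp2_r n n) \<otimes>\<^bsub>?B\<^esub> inv\<^bsub>?B\<^esub> (rp2_r n (n - 1)) \<otimes>\<^bsub>?B\<^esub> rp2_r n n \<otimes>\<^bsub>?B\<^esub> rp2_r n (n - 1)"
      using r_comm[of "n - 1"] n by simp
    hence "p ((b \<otimes>\<^bsub>?B\<^esub> inv\<^bsub>?B\<^esub> a) \<otimes>\<^bsub>?B\<^esub> (b \<otimes>\<^bsub>?B\<^esub> inv\<^bsub>?B\<^esub> a)) =
        p (inv\<^bsub>?B\<^esub> (rp2_r n n) \<otimes>\<^bsub>?B\<^esub> inv\<^bsub>?B\<^esub> (rp2_r n (n - 1)) \<otimes>\<^bsub>?B\<^esub> rp2_r n n \<otimes>\<^bsub>?B\<^esub> rp2_r n (n - 1))"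
      by (rule arg_cong)
    hence "(p b \<otimes>\<^bsub>M\<^esub> inv\<^bsub>M\<^esub> p a) \<otimes>\<^bsub>M\<^esub> (p b \<otimes>\<^bsub>M\<^esub> inv\<^bsub>M\<^esub> p a) =
        inv\<^bsub>M\<^esub> p (rp2_r n n) \<otimes>\<^bsub>M\<^esub> inv\<^bsub>M\<^esub> p (rp2_r n (n - 1)) \<otimes>\<^bsub>M\<^esub> p (rp2_r n n) \<otimes>\<^bsub>M\<^esub> p (rp2_r n (n - 1))"
      by simp
    thus "\<exists>x\<in>carrier M. \<exists>y\<in>carrier M. (p b \<otimes>\<^bsub>M\<^esub> inv\<^bsub>M\<^esub> p a) \<otimes>\<^bsub>M\<^esub> (p b \<otimes>\<^bsub>M\<^esub> inv\<^bsub>M\<^esub> p a)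
        = inv\<^bsub>M\<^esub> x \<otimes>\<^bsub>M\<^esub> inv\<^bsub>M\<^esub> y \<otimes>\<^bsub>M\<^esub> x \<otimes>\<^bsub>M\<^esub> y"
      using p.hom_closed r_closed by blast
    show "\<exists>h\<in>hom M ?V. \<exists>g\<in>carrier M. \<exists>g'\<in>carrier M. h g = (1, 0) \<and> h g' = (0, 1)"
      using k q(2)[of 1] q(3)[of 1] n
      by (intro bexI[of _ k] bexI[of _ "p (rp2_s n 1)"] bexI[of _ "p (rp2_r n 1)"]) auto
  qed (use n in auto)
  thus ?thesis by (simp add: rp2_braid_mod_twist_def tc a b M_def)
qed

section \<open>The unit of the mapping class group\<close>

lemma homeo_group_one_closed:
  assumes "Q \<subseteq> topspace T"
  shows "\<one>\<^bsub>homeo_group T Q\<^esub> \<in> carrier (homeo_group T Q)"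
proof -
  have "homeomorphic_map T T (restrict id (topspace T))"
    using homeomorphic_map_eq[OF homeomorphic_map_id[THEN iffD2], of T T] by fastforce
  moreover have "restrict id (topspace T) ` Q = Q"
    using assms by (auto simp: image_def)
  ultimately show ?thesis by (simp add: homeo_group_def)
qed

lemma homeo_group_mult_closed:
  assumes "Q \<subseteq> topspace T" "f \<in> carrier (homeo_group T Q)" "g \<in> carrier (homeo_group T Q)"
  shows "f \<otimes>\<^bsub>homeo_group T Q\<^esub> g \<in> carrier (homeo_group T Q)"
proof -
  have "homeomorphic_map T T (f \<circ> g)"
    using assms by (auto simp: homeo_group_def intro: homeomorphic_map_compose)
  hence "homeomorphic_map T T (compose (topspace T) f g)"
    by (rule homeomorphic_map_eq) (auto simp: compose_def)
  moreover have "compose (topspace T) f g ` Q = f ` g ` Q"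
    using assms(1) by (force simp: compose_def image_image)
  ultimately show ?thesis
    using assms(2,3) by (auto simp: homeo_group_def)
qed

lemma isotopic_rel_refl:
  assumes "f \<in> carrier (homeo_group T Q)"
  shows "(f, f) \<in> isotopic_rel T Q"
  using assms by (auto simp: isotopic_rel_def homeo_group_def homeomorphic_imp_continuous_map)

text \<open>The relation records agreement on the marked points with its left argument. Isotopic maps agree there, so that
  either argument may serve as the reference.\<close>

lemma isotopic_rel_agree: "(f, g) \<in> isotopic_rel T Q \<Longrightarrow> x \<in> Q \<Longrightarrow> g x = f x"
  by (auto simp: isotopic_rel_def dest: homotopic_with_imp_property)

lemma sym_isotopic_rel: "sym (isotopic_rel T Q)"
proof (rule symI)
  fix f g assume fg: "(f, g) \<in> isotopic_rel T Q"
  hence "(\<lambda>h. homeomorphic_map T T h \<and> (\<forall>x\<in>Q. h x = f x)) =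
      (\<lambda>h. homeomorphic_map T T h \<and> (\<forall>x\<in>Q. h x = g x))"
    by (simp add: isotopic_rel_agree[OF fg])
  thus "(g, f) \<in> isotopic_rel T Q"
    using fg by (auto simp: isotopic_rel_def intro: homotopic_with_symD)
qed

lemma trans_isotopic_rel: "trans (isotopic_rel T Q)"
proof (rule transI)
  fix f g h assume fg: "(f, g) \<in> isotopic_rel T Q" and gh: "(g, h) \<in> isotopic_rel T Q"
  from fg have "(\<lambda>h. homeomorphic_map T T h \<and> (\<forall>x\<in>Q. h x = f x)) =
      (\<lambda>h. homeomorphic_map T T h \<and> (\<forall>x\<in>Q. h x = g x))"
    by (simp add: isotopic_rel_agree[OF fg])
  thus "(f, h) \<in> isotopic_rel T Q"
    using fg gh by (auto simp: isotopic_rel_def intro: homotopic_with_trans)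
qed

text \<open>The isotopy from the identity to \<open>f\<close> is continued by \<open>f\<close> composed with the isotopy from the identity to \<open>g\<close>;
  the latter leads from \<open>f\<close> to the product.\<close>

lemma isotopic_to_one_mult:
  assumes Q: "Q \<subseteq> topspace T"
    and f: "(\<one>\<^bsub>homeo_group T Q\<^esub>, f) \<in> isotopic_rel T Q"
    and g: "(\<one>\<^bsub>homeo_group T Q\<^esub>, g) \<in> isotopic_rel T Q"
  shows "(\<one>\<^bsub>homeo_group T Q\<^esub>, f \<otimes>\<^bsub>homeo_group T Q\<^esub> g) \<in> isotopic_rel T Q"
proof -
  let ?e = "\<one>\<^bsub>homeo_group T Q\<^esub>"
  let ?P = "\<lambda>h. homeomorphic_map T T h \<and> (\<forall>x\<in>Q. h x = ?e x)"
  have e: "?e = restrict id (topspace T)" by (simp add: homeo_group_def)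
  have carr: "f \<in> carrier (homeo_group T Q)" "g \<in> carrier (homeo_group T Q)"
    and hf: "homotopic_with ?P T T ?e f" and hg: "homotopic_with ?P T T ?e g"
    using f g by (auto simp: isotopic_rel_def)
  have fx: "f x = x" if "x \<in> Q" for x
    using isotopic_rel_agree[OF f that] that Q by (auto simp: e)
  have f_homeo: "homeomorphic_map T T f"
    using carr by (simp add: homeo_group_def)
  have P_eq: "?P h = ?P k" if "\<And>x. x \<in> topspace T \<Longrightarrow> h x = k x" for h k
  proof -
    have "homeomorphic_map T T h \<longleftrightarrow> homeomorphic_map T T k"
      using that by (metis homeomorphic_map_eq)
    moreover have "h x = k x" if "x \<in> Q" for x
      using that Q \<open>\<And>x. x \<in> topspace T \<Longrightarrow> h x = k x\<close> by blast
    ultimately show ?thesis by simp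
  qed
  have "homotopic_with ?P T T (f \<circ> ?e) (f \<circ> g)"
    using f_homeo fx Q
    by (intro homotopic_with_compose_continuous_map_left[OF hg])
       (auto simp: homeomorphic_imp_continuous_map e intro: homeomorphic_map_compose)
  hence "homotopic_with ?P T T f (f \<otimes>\<^bsub>homeo_group T Q\<^esub> g)"
  proof (rule homotopic_with_eq)
    show "?P h = ?P k" if "\<And>x. x \<in> topspace T \<Longrightarrow> h x = k x" for h k
      using that by (rule P_eq)
  qed (auto simp: e homeo_group_def compose_def)
  with hf have "homotopic_with ?P T T ?e (f \<otimes>\<^bsub>homeo_group T Q\<^esub> g)"
    by (rule homotopic_with_trans)
  thus ?thesis
    using carr Q homeo_group_mult_closed homeo_group_one_closed
    by (auto simp: isotopic_rel_def)
qed

text \<open>The only fact about mapping class groups that an isomorphism from a group does not provide: an isomorphism carries the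
  unit to a unit, but does not show that this is the class of the identity.\<close>

lemma mapping_class_group_one_idem:
  assumes Q: "Q \<subseteq> topspace T"
  shows "\<one>\<^bsub>mapping_class_group T Q\<^esub> \<in> carrier (mapping_class_group T Q)"
    and "\<one>\<^bsub>mapping_class_group T Q\<^esub> \<otimes>\<^bsub>mapping_class_group T Q\<^esub> \<one>\<^bsub>mapping_class_group T Q\<^esub> =
      \<one>\<^bsub>mapping_class_group T Q\<^esub>"
proof -
  let ?G = "homeo_group T Q" and ?r = "isotopic_rel T Q"
  let ?E = "?r `` {\<one>\<^bsub>?G\<^esub>}"
  have e: "\<one>\<^bsub>?G\<^esub> \<in> carrier ?G" using Q by (rule homeo_group_one_closed)
  show "\<one>\<^bsub>mapping_class_group T Q\<^esub> \<in> carrier (mapping_class_group T Q)"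
    using e by (auto simp: mapping_class_group_def quotient_monoid_def intro: quotientI)
  have "?r `` {f \<otimes>\<^bsub>?G\<^esub> g} = ?E" if "f \<in> ?E" "g \<in> ?E" for f g
    using isotopic_to_one_mult[OF Q, of f g] that
      symD[OF sym_isotopic_rel, of _ _ T Q] transD[OF trans_isotopic_rel, of _ _ T Q] by blast
  moreover have "\<one>\<^bsub>?G\<^esub> \<in> ?E" using isotopic_rel_refl[OF e] by blast
  ultimately have "(\<Union>f\<in>?E. \<Union>g\<in>?E. ?r `` {f \<otimes>\<^bsub>?G\<^esub> g}) = ?E" by blast
  thus "\<one>\<^bsub>mapping_class_group T Q\<^esub> \<otimes>\<^bsub>mapping_class_group T Q\<^esub> \<one>\<^bsub>mapping_class_group T Q\<^esub> =
      \<one>\<^bsub>mapping_class_group T Q\<^esub>"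
    by (simp add: mapping_class_group_def quotient_monoid_def)
qed

section \<open>Generators, normal generators and quotients\<close>

theorem proposition16:
  fixes n :: nat
  assumes "n \<ge> 2"
  shows
    "(let M = rp2_braid_mod_twist n;
          a = twist_class n (braid_a n);
          b = twist_class n (braid_b n)
      in
        group M \<and> a \<in> carrier M \<and> b \<in> carrier M \<and>
        generate M {a, b} = carrier M \<and> group.ord M a = 2 * n \<and> group.ord M b = 2 * (n - 1) \<and>
        gen_rank M = 2 \<and> torsion_gen_rank M = 2 \<and>
        (\<forall>x\<in>carrier M. subgroup (normal_closure M {x}) M \<and> normal_closure M {x} \<noteq> carrier M) \<and>
        torsion_normal_gen_rank M = 2 \<and> normal_gen_rank M = 2 \<and>
        (\<forall>k. \<not> strongly_torsion_generated k M) \<and>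
        M Mod normal_closure M {a} \<cong> integer_mod_group 2 \<and>
        M Mod normal_closure M {b} \<cong> integer_mod_group 2)
   \<and> (\<forall>Q \<phi>. Q \<subseteq> topspace rp2 \<and> card Q = n \<and>
        \<phi> \<in> iso (rp2_braid_mod_twist n) (mapping_class_group rp2 Q) \<longrightarrow>
      (let M = mapping_class_group rp2 Q;
           a = \<phi> (twist_class n (braid_a n));
           b = \<phi> (twist_class n (braid_b n))
       in
         group M \<and> a \<in> carrier M \<and> b \<in> carrier M \<and>
         generate M {a, b} = carrier M \<and> group.ord M a = 2 * n \<and> group.ord M b = 2 * (n - 1) \<and>
         gen_rank M = 2 \<and> torsion_gen_rank M = 2 \<and>
         (\<forall>x\<in>carrier M. subgroup (normal_closure M {x}) M \<and> normal_closure M {x} \<noteq> carrier M) \<and>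
         torsion_normal_gen_rank M = 2 \<and> normal_gen_rank M = 2 \<and>
         (\<forall>k. \<not> strongly_torsion_generated k M) \<and>
         M Mod normal_closure M {a} \<cong> integer_mod_group 2 \<and>
         M Mod normal_closure M {b} \<cong> integer_mod_group 2))"
proof -
  let ?M = "rp2_braid_mod_twist n"
  interpret M: rotation_generated_group ?M n "twist_class n (braid_a n)" "twist_class n (braid_b n)"
    using assms by (rule rotation_generated_rp2_braid_mod_twist)
  have image: "rotation_generated_group (mapping_class_group rp2 Q) n
      (\<phi> (twist_class n (braid_a n))) (\<phi> (twist_class n (braid_b n)))"
    if "Q \<subseteq> topspace rp2 \<and> card Q = n \<and> \<phi> \<in> iso ?M (mapping_class_group rp2 Q)" for Q \<phi>
  proof (rule M.iso_image)
    show "\<phi> \<in> iso ?M (mapping_class_group rp2 Q)" using that by blast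
    thus "group (mapping_class_group rp2 Q)"
      using that by (intro M.iso_group_transport mapping_class_group_one_idem) auto
  qed
  show ?thesis
    unfolding Let_def
    by (intro conjI[OF M.conclusions] allI impI)
       (rule rotation_generated_group.conclusions[OF image])
qed

end
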